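(* Let $d\ge1$, $\alpha>0$, and let $\Omega\subset\mathbb R^d$ be open, bounded and connected with Lipschitz boundary. Assume that $m:[0,\infty)\to[0,\infty)$ is continuous and satisfies $$\lim_{u\to\infty}\frac{m(u)}{u}=\infty\quad\text{and}\quad m^{-1}(0)=\{0\}.$$ Then $$d_m^{\frac{\alpha+1}{\alpha}}(u_0,u_1)=0$$ for all pairs $u_0,u_1\in L_1(\Omega)$ with $\bar u_0=\bar u_1$ and $\inf_\Omega u_0>0$, $\inf_\Omega u_1>0$.
   Context: For non-negative $u_0,u_1\in L_1(\Omega)$ with equal means $\bar u_0=\bar u_1$ (where $\bar w=\frac{1}{|\Omega|}\int_\Omega w\,dx$), the Benamou--Brenier action is $$d_m^{\frac{\alpha+1}{\alpha}}(u_0,u_1):=\inf\left\{\int_0^1\int_\Omega\frac{|j|^{\frac{\alpha+1}{\alpha}}}{m(u)^{\frac1\alpha}}\,dx\,dt\ :\ \partial_tu+\operatorname{div}j=0,\ j\cdot n=0\text{ on }\partial\Omega,\ u\ge0,\ u(0,x)=u_0(x),\ u(1,x)=u_1(x)\right\},$$ where the infimum runs over pairs $(u,j)$ on $[0,1]\times\Omega$, $n$ is the outer normal, and the continuity equation with no-flux boundary condition is understood in the sense of distributions. Infima of $L_1$ functions are essential infima. *)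

theory Defs
  imports "HOL-Analysis.Analysis"
begin

text \<open>Near each boundary point \<open>\<Omega>\<close> is the strict epigraph of a Lipschitz function
  over the hyperplane orthogonal to some unit vector \<open>e\<close> (the inward direction);
  \<open>x - (x \<bullet> e) *\<^sub>R e\<close> is the orthogonal projection of \<open>x\<close> onto that hyperplane.\<close>

definition lipschitz_boundary :: "'a::euclidean_space set \<Rightarrow> bool" where
  "lipschitz_boundary \<Omega> \<longleftrightarrow>
     (\<forall>p\<in>frontier \<Omega>. \<exists>e r L \<gamma>. norm e = 1 \<and> r > 0 \<and> L-lipschitz_on {y. y \<bullet> e = 0} \<gamma> \<and>
        \<Omega> \<inter> ball p r = {x \<in> ball p r. \<gamma> (x - (x \<bullet> e) *\<^sub>R e) < x \<bullet> e})"

definition mean :: "'a::euclidean_space set \<Rightarrow> ('a \<Rightarrow> real) \<Rightarrow> real" where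
  "mean \<Omega> w = 1 / measure lebesgue \<Omega> * (LINT x|lebesgue_on \<Omega>. w x)"

definition ess_inf :: "'a measure \<Rightarrow> ('a \<Rightarrow> real) \<Rightarrow> ereal" where
  "ess_inf M f = Sup {c. AE x in M. c \<le> ereal (f x)}"

primrec C_k :: "nat \<Rightarrow> ('b::real_normed_vector \<Rightarrow> real) \<Rightarrow> bool" where
  "C_k 0 f \<longleftrightarrow> continuous_on UNIV f"
| "C_k (Suc k) f \<longleftrightarrow>
     (\<forall>z. f differentiable (at z)) \<and> (\<forall>v. C_k k (\<lambda>z. frechet_derivative f (at z) v))"

definition test_function :: "('b::real_normed_vector \<Rightarrow> real) \<Rightarrow> bool" where
  "test_function \<phi> \<longleftrightarrow> (\<forall>k. C_k k \<phi>) \<and> compact (closure {z. \<phi> z \<noteq> 0})"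

text \<open>Distributional form of \<open>\<partial>\<^sub>t u + div j = 0\<close> on \<open>[0,1] \<times> \<Omega>\<close> with no flux through
  \<open>\<partial>\<Omega>\<close> and with \<open>u(0,\<cdot>) = u0\<close>, \<open>u(1,\<cdot>) = u1\<close>. The test functions live on the whole of
  \<open>\<real> \<times> \<real>\<^sup>d\<close> and need not vanish on \<open>\<partial>\<Omega>\<close> or at times \<open>0\<close> and \<open>1\<close>; this is what encodes
  the no-flux and the initial and terminal conditions. The derivative of \<open>\<phi>\<close> in direction
  \<open>(1, 0)\<close> is \<open>\<partial>\<^sub>t \<phi>\<close>, and that in direction \<open>(0, j)\<close> is \<open>j \<bullet> \<nabla>\<phi>\<close>.\<close>

definition continuity_eq ::
  "'a::euclidean_space set \<Rightarrow> (real \<times> 'a \<Rightarrow> real) \<Rightarrow> (real \<times> 'a \<Rightarrow> 'a) \<Rightarrow>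
     ('a \<Rightarrow> real) \<Rightarrow> ('a \<Rightarrow> real) \<Rightarrow> bool" where
  "continuity_eq \<Omega> u j u0 u1 \<longleftrightarrow>
     (\<forall>\<phi> :: real \<times> 'a \<Rightarrow> real. test_function \<phi> \<longrightarrow>
        (LINT z|lebesgue_on ({0..1} \<times> \<Omega>).
            u z * frechet_derivative \<phi> (at z) (1, 0) + frechet_derivative \<phi> (at z) (0, j z))
        = (LINT x|lebesgue_on \<Omega>. u1 x * \<phi> (1, x)) - (LINT x|lebesgue_on \<Omega>. u0 x * \<phi> (0, x)))"

definition admissible ::
  "'a::euclidean_space set \<Rightarrow> ('a \<Rightarrow> real) \<Rightarrow> ('a \<Rightarrow> real) \<Rightarrow>
     ((real \<times> 'a \<Rightarrow> real) \<times> (real \<times> 'a \<Rightarrow> 'a)) set" where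
  "admissible \<Omega> u0 u1 =
     {(u, j). integrable (lebesgue_on ({0..1} \<times> \<Omega>)) u \<and>
              integrable (lebesgue_on ({0..1} \<times> \<Omega>)) j \<and>
              (AE z in lebesgue_on ({0..1} \<times> \<Omega>). 0 \<le> u z) \<and>
              continuity_eq \<Omega> u j u0 u1}"

text \<open>Division in \<^typ>\<open>ennreal\<close> gives the usual conventions where \<open>m (u z) = 0\<close>: the integrand is
  \<open>0\<close> if \<open>j z = 0\<close> and \<open>\<infinity>\<close> otherwise.\<close>

definition action ::
  "real \<Rightarrow> (real \<Rightarrow> real) \<Rightarrow> 'a::euclidean_space set \<Rightarrow>
     (real \<times> 'a \<Rightarrow> real) \<Rightarrow> (real \<times> 'a \<Rightarrow> 'a) \<Rightarrow> ennreal" where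
  "action \<alpha> m \<Omega> u j =
     (\<integral>\<^sup>+z. ennreal (norm (j z) powr ((\<alpha> + 1) / \<alpha>)) / ennreal (m (u z) powr (1 / \<alpha>))
        \<partial>lebesgue_on ({0..1} \<times> \<Omega>))"

text \<open>The quantity \<open>d\<^sub>m(u0, u1)\<close> raised to the power \<open>(\<alpha> + 1) / \<alpha>\<close>; it is \<open>\<infinity>\<close> if there is no
  admissible pair.\<close>

definition bb_action ::
  "real \<Rightarrow> (real \<Rightarrow> real) \<Rightarrow> 'a::euclidean_space set \<Rightarrow> ('a \<Rightarrow> real) \<Rightarrow> ('a \<Rightarrow> real) \<Rightarrow> ennreal" where
  "bb_action \<alpha> m \<Omega> u0 u1 = (INF (u, j) \<in> admissible \<Omega> u0 u1. action \<alpha> m \<Omega> u j)"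

end

theory Submission
  imports Defs "HOL-Probability.Probability_Measure"
begin

text \<open>
  Write \<open>u\<^sub>i = \<delta> + v\<^sub>i\<close> with a small constant \<open>\<delta> > 0\<close>. The background \<open>\<delta>\<close> stays at rest and makes \<open>m(u) \<ge> c u\<close>
  everywhere, so a flux with \<open>|j| \<le> V u\<close> costs at most a constant times \<open>V\<^sup>p \<integral>u\<close>, \<open>p = (\<alpha> + 1)/\<alpha>\<close>;
  where \<open>u\<close> is so large that \<open>m(u) \<ge> K u\<close>, that constant is \<open>K\<^bsup>1-p\<^esup>\<close>. The mass \<open>v\<^sub>0\<close> is moved in three phases.
  First, \<open>\<Omega>\<close> is cut into finitely many cells of diameter \<open>O(\<epsilon>)\<close>, each joined to all points of some
  nearby ball by segments inside \<open>\<Omega>\<close>, and the mass of each cell is contracted, at speed \<open>O(\<epsilon>)\<close>, to a uniform density on a tiny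
  ball inside \<open>\<Omega>\<close>. Then pieces of these balls travel rigidly along fixed smooth paths, at a speed \<open>D\<close>
  that does not depend on the radius of the balls; small radii make the density, hence \<open>K\<close>, as large as
  we like. Finally the first phase for \<open>v\<^sub>1\<close> is run backwards. Choosing first \<open>\<epsilon>\<close>, then \<open>K\<close>, then the
  radius makes the total cost arbitrarily small.
\<close>

section \<open>Superposition of moving balls\<close>

text \<open>For a general \<open>m\<close> the action is not convex in (u, j), so the cost of a
  superposition is not controlled by the costs of its parts. What survives averaging is the linear
  inequality |j| \<le> V u. Since x^p / y^(p-1) is homogeneous of degree one, |j| \<le> A u and m(u)
  \<ge> B u bound the integrand by a multiple of u, whose integral is the conserved mass. The data
  are merely integrable, and sending a whole cell to a point would create Dirac masses. So each
  point of the mass is blown up to a ball whose radius grows while its center approaches the target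
  and shrinks again at the end. The radius is zero only at times 0 and 1, hence the prescribed
  densities are attained exactly, as laws of the centers, without any regularity. Overlapping balls
  do no harm, because the continuity equation is linear in (u, j). In the travel phase the density
  is either zero, and then so is the flux, or at least one ball height times the least positive
  weight of a pair of cells. There are finitely many such pairs, and their weights are known before
  the radius is chosen.\<close>

definition ball_density :: "'a::euclidean_space \<Rightarrow> real \<Rightarrow> 'a \<Rightarrow> real" where
  "ball_density a r z = (if dist a z < r then 1 / (unit_ball_vol (real DIM('a)) * r ^ DIM('a)) else 0)"

lemma ball_density_nonneg: "0 \<le> ball_density a r z"
proof (cases "dist a z < r")
  case True
  then have "0 < r" using zero_le_dist[of a z] by linarith
  then show ?thesis by (simp add: ball_density_def)
qed (simp add: ball_density_def)

lemma ball_density_measurable [measurable (raw)]: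
  assumes [measurable]: "a \<in> borel_measurable M" "r \<in> borel_measurable M" "z \<in> borel_measurable M"
  shows "(\<lambda>x. ball_density (a x) (r x) (z x :: 'a::euclidean_space)) \<in> borel_measurable M"
  unfolding ball_density_def by measurable

lemma nn_integral_ball_density:
  assumes "0 < r"
  shows "(\<integral>\<^sup>+z. ennreal (ball_density a r z) \<partial>lborel) = 1"
proof -
  let ?c = "1 / (unit_ball_vol (real DIM('a)) * r ^ DIM('a))"
  have "(\<integral>\<^sup>+z. ennreal (ball_density a r z) \<partial>lborel) = (\<integral>\<^sup>+z. ennreal ?c * indicator (ball a r) z \<partial>lborel)"
    by (intro nn_integral_cong) (auto simp: ball_density_def indicator_def)
  also have "\<dots> = ennreal ?c * emeasure lborel (ball a r)"
    by (simp add: nn_integral_cmult_indicator)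
  also have "\<dots> = 1"
    using assms less_imp_neq[OF unit_ball_vol_pos[of "real DIM('a)"], symmetric] by (simp add: emeasure_ball ennreal_mult[symmetric])
  finally show ?thesis .
qed

text \<open>The substitution z = a + r w absorbs the factor r^d into the normalization. In the
  coordinate w the domain of integration no longer moves with time, which prepares the interchange
  of time and space integrals.\<close>

lemma integral_ball_density:
  fixes h :: "'a::euclidean_space \<Rightarrow> real"
  assumes r: "0 < r" and [measurable]: "h \<in> borel_measurable borel"
  shows "(\<integral>z. ball_density a r z * h z \<partial>lborel) = (\<integral>w. ball_density 0 1 w * h (a + r *\<^sub>R w) \<partial>lborel)"
proof -
  have "(\<integral>z. ball_density a r z * h z \<partial>lborel) =
      (\<integral>z. ball_density a r z * h z \<partial>density (distr lborel borel (\<lambda>x. a + r *\<^sub>R x)) (\<lambda>_. ennreal (\<bar>r\<bar>^DIM('a))))"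
    using lborel_affine[of r a] r by simp
  also have "\<dots> = (\<integral>w. \<bar>r\<bar>^DIM('a) * (ball_density a r (a + r *\<^sub>R w) * h (a + r *\<^sub>R w)) \<partial>lborel)"
    by (simp add: integral_density integral_distr)
  also have "\<dots> = (\<integral>w. ball_density 0 1 w * h (a + r *\<^sub>R w) \<partial>lborel)"
    using r by (intro Bochner_Integration.integral_cong) (auto simp: ball_density_def dist_norm)
  finally show ?thesis .
qed

text \<open>A bounded slope on the open interval is Lebesgue integrable there, so the gauge-integral
  form of the fundamental theorem, which tolerates the finitely many corners in \<open>S\<close>,
  carries over to \<open>lborel\<close>.\<close>

lemma integral_deriv_unit_interval:
  fixes G :: "real \<Rightarrow> real"
  assumes "finite S" "continuous_on {0..1} G"
    and D: "\<And>t. t \<in> {0<..<1} - S \<Longrightarrow> (G has_vector_derivative G' t) (at t)"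
    and [measurable]: "G' \<in> borel_measurable borel" and b: "\<And>t. t \<in> {0<..<1} \<Longrightarrow> \<bar>G' t\<bar> \<le> C"
  shows "(\<integral>t. indicator {0<..<1} t * G' t \<partial>lborel) = G 1 - G 0"
proof -
  have "(G' has_integral (G 1 - G 0)) {0..1}"
    by (rule fundamental_theorem_of_calculus_interior_strong[OF \<open>finite S\<close> _ D assms(2)]) auto
  then have i1: "(G' has_integral (G 1 - G 0)) {0<..<1}"
    by (simp add: has_integral_Icc_iff_Ioo)
  have "integrable lborel (\<lambda>t. C * indicator {0<..<1::real} t)"
    by (intro integrable_mult_right integrable_real_indicator) auto
  then have s: "set_integrable lborel {0<..<1} G'"
    unfolding set_integrable_def
    by (rule Bochner_Integration.integrable_bound) (use b in \<open>force simp: indicator_def split: if_splits\<close>)+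
  have "(LINT x : {0<..<1} | lborel. G' x) = G 1 - G 0"
    using set_borel_integral_eq_integral(2)[OF s] i1 by (simp add: integral_unique)
  then show ?thesis by (simp add: set_lebesgue_integral_def)
qed

text \<open>Each parameter \<open>\<theta>\<close> carries a uniform unit mass on the ball with center \<open>A t \<theta>\<close> and radius \<open>s t\<close>; the
  point with relative position \<open>w\<close> in the unit ball moves with velocity \<open>A' t \<theta> + s' t *\<^sub>R w\<close>. As the radius
  vanishes only at times 0 and 1, averaging over \<open>\<theta>\<close> gives a density at every time in between,
  however singular the law of the centers is.\<close>

locale moving_balls = prob_space \<Theta> for \<Theta> :: "'c measure" +
  fixes A A' :: "real \<Rightarrow> 'c \<Rightarrow> 'a::euclidean_space" and s s' B :: "real \<Rightarrow> real"
    and S :: "real set" and C :: real and \<Omega> :: "'a set"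
  assumes center_measurable [measurable]: "case_prod A \<in> borel_measurable (borel \<Otimes>\<^sub>M \<Theta>)"
    and center_deriv_measurable [measurable]: "case_prod A' \<in> borel_measurable (borel \<Otimes>\<^sub>M \<Theta>)"
    and radius_measurable [measurable]: "s \<in> borel_measurable borel" "s' \<in> borel_measurable borel"
    and finite_S: "finite S"
    and center_continuous: "\<And>\<theta>. \<theta> \<in> space \<Theta> \<Longrightarrow> continuous_on {0..1} (\<lambda>t. A t \<theta>)"
    and center_deriv: "\<And>t \<theta>. t \<in> {0<..<1} - S \<Longrightarrow> \<theta> \<in> space \<Theta> \<Longrightarrow>
        ((\<lambda>t. A t \<theta>) has_vector_derivative A' t \<theta>) (at t)"
    and radius_continuous: "continuous_on {0..1} s"
    and radius_deriv: "\<And>t. t \<in> {0<..<1} - S \<Longrightarrow> (s has_vector_derivative s' t) (at t)"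
    and radius_pos: "\<And>t. t \<in> {0<..<1} \<Longrightarrow> 0 < s t"
    and radius_ends: "s 0 = 0" "s 1 = 0"
    and inside: "\<And>t \<theta>. t \<in> {0<..<1} \<Longrightarrow> \<theta> \<in> space \<Theta> \<Longrightarrow> ball (A t \<theta>) (s t) \<subseteq> \<Omega>"
    and speed: "\<And>t \<theta> w. t \<in> {0<..<1} \<Longrightarrow> \<theta> \<in> space \<Theta> \<Longrightarrow> w \<in> ball 0 1 \<Longrightarrow>
        norm (A' t \<theta> + s' t *\<^sub>R w) \<le> B t"
    and speed_bound: "\<And>t. t \<in> {0<..<1} \<Longrightarrow> B t \<le> C"
    and bounded_domain: "bounded \<Omega>"
begin

definition k :: "real \<times> 'a \<Rightarrow> 'c \<Rightarrow> real" where
  "k p \<theta> = indicator {0<..<1} (fst p) * ball_density (A (fst p) \<theta>) (s (fst p)) (snd p)"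

text \<open>Eulerian form of the particle velocity: the particle found at z has relative position w
  = (z - A) / s, and w is constant along its path.\<close>

definition V :: "real \<times> 'a \<Rightarrow> 'c \<Rightarrow> 'a" where
  "V p \<theta> = A' (fst p) \<theta> + (s' (fst p) / s (fst p)) *\<^sub>R (snd p - A (fst p) \<theta>)"

text \<open>Density and flux are averaged, not density and velocity: the continuity equation is
  linear in the former pair.\<close>

definition F :: "real \<times> 'a \<Rightarrow> real" where "F p = (\<integral>\<theta>. k p \<theta> \<partial>\<Theta>)"

definition J :: "real \<times> 'a \<Rightarrow> 'a" where "J p = (\<integral>\<theta>. k p \<theta> *\<^sub>R V p \<theta> \<partial>\<Theta>)"

lemma C_nonneg: "0 \<le> C"
proof -
  obtain \<theta> where \<theta>: "\<theta> \<in> space \<Theta>" using not_empty by blast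
  have "0 \<le> B (1/2)" using order_trans[OF norm_ge_zero speed[of "1/2" \<theta> 0]] \<theta> by auto
  then show ?thesis using speed_bound[of "1/2"] by auto
qed

lemma k_nonneg: "0 \<le> k p \<theta>"
  by (simp add: k_def ball_density_nonneg)

lemma k_nonzeroD:
  assumes "k p \<theta> \<noteq> 0" "\<theta> \<in> space \<Theta>"
  shows "0 < fst p" "fst p < 1" "snd p \<in> \<Omega>" "norm (V p \<theta>) \<le> B (fst p)"
proof -
  obtain t z where p: "p = (t, z)" by force
  have t: "t \<in> {0<..<1}" and d: "dist (A t \<theta>) z < s t"
    using assms(1) by (auto simp: p k_def indicator_def ball_density_def split: if_splits)
  note st = radius_pos[OF t]
  show "0 < fst p" "fst p < 1" using t by (auto simp: p)
  show "snd p \<in> \<Omega>" using inside[OF t assms(2)] d by (auto simp: p)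
  have "inverse (s t) *\<^sub>R (z - A t \<theta>) \<in> ball 0 1"
    using d st by (simp add: dist_norm norm_minus_commute) (simp add: field_simps)
  from speed[OF t assms(2) this] show "norm (V p \<theta>) \<le> B (fst p)"
    by (simp add: p V_def divide_inverse)
qed

lemma center_measurable' [measurable (raw)]:
  assumes "f \<in> borel_measurable M" "g \<in> measurable M \<Theta>"
  shows "(\<lambda>x. A (f x) (g x)) \<in> borel_measurable M" "(\<lambda>x. A' (f x) (g x)) \<in> borel_measurable M"
  using measurable_compose[OF measurable_Pair[OF assms] center_measurable]
    measurable_compose[OF measurable_Pair[OF assms] center_deriv_measurable] by auto

lemma borel_fst_snd:
  "fst \<in> borel_measurable (borel :: (real \<times> 'a) measure)" "snd \<in> borel_measurable (borel :: (real \<times> 'a) measure)"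
  unfolding borel_prod[symmetric] by measurable

lemma borel_fst_snd' [measurable (raw)]:
  assumes "f \<in> measurable M (borel :: (real \<times> 'a) measure)"
  shows "(\<lambda>x. fst (f x)) \<in> borel_measurable M" "(\<lambda>x. snd (f x)) \<in> borel_measurable M"
  using measurable_compose[OF assms borel_fst_snd(1)] measurable_compose[OF assms borel_fst_snd(2)] by auto

lemma k_measurable [measurable (raw)]:
  assumes [measurable]: "f \<in> borel_measurable M" "g \<in> measurable M \<Theta>"
  shows "(\<lambda>x. k (f x) (g x)) \<in> borel_measurable M"
  unfolding k_def by measurable

lemma V_measurable [measurable (raw)]:
  assumes [measurable]: "f \<in> borel_measurable M" "g \<in> measurable M \<Theta>"
  shows "(\<lambda>x. V (f x) (g x)) \<in> borel_measurable M"
  unfolding V_def by measurable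

sublocale PP: pair_sigma_finite "lborel :: (real \<times> 'a) measure" \<Theta> ..

lemma nn_integral_k:
  assumes "\<theta> \<in> space \<Theta>"
  shows "(\<integral>\<^sup>+p. ennreal (k p \<theta>) \<partial>lborel) = 1"
proof -
  have "(\<integral>\<^sup>+p. ennreal (k p \<theta>) \<partial>lborel) = (\<integral>\<^sup>+t. \<integral>\<^sup>+z. ennreal (k (t, z) \<theta>) \<partial>lborel \<partial>lborel)"
    using assms lborel.nn_integral_fst[of "\<lambda>p. ennreal (k p \<theta>)"] by (simp add: lborel_prod)
  also have "\<dots> = (\<integral>\<^sup>+t. indicator {0<..<1::real} t \<partial>lborel)"
    by (intro nn_integral_cong) (auto simp: k_def indicator_def nn_integral_ball_density radius_pos)
  finally show ?thesis by simp
qed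

lemma integrable_k: "integrable (lborel \<Otimes>\<^sub>M \<Theta>) (\<lambda>(p, \<theta>). k p \<theta>)"
proof (rule integrableI_nonneg)
  have "(\<integral>\<^sup>+x. ennreal (case x of (p, \<theta>) \<Rightarrow> k p \<theta>) \<partial>(lborel \<Otimes>\<^sub>M \<Theta>)) = (\<integral>\<^sup>+\<theta>. \<integral>\<^sup>+p. ennreal (k p \<theta>) \<partial>lborel \<partial>\<Theta>)"
    by (subst PP.nn_integral_snd[symmetric]) simp_all
  also have "\<dots> = 1" by (simp add: nn_integral_k emeasure_space_1 cong: nn_integral_cong)
  finally show "(\<integral>\<^sup>+x. ennreal (case x of (p, \<theta>) \<Rightarrow> k p \<theta>) \<partial>(lborel \<Otimes>\<^sub>M \<Theta>)) < \<infinity>" by simp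
qed (auto simp: k_nonneg)

text \<open>All balls share one radius at a given time, so a single height bounds them all and the
  averages exist at every point, not just almost everywhere. The absolute value keeps the bound
  nonnegative at times where the sign of \<open>s\<close> is not prescribed.\<close>

lemma integrable_k_\<theta>: "integrable \<Theta> (k p)"
proof (rule integrable_const_bound[of _ "1 / (unit_ball_vol (real DIM('a)) * \<bar>s (fst p)\<bar> ^ DIM('a))"])
  show "AE \<theta> in \<Theta>. norm (k p \<theta>) \<le> 1 / (unit_ball_vol (real DIM('a)) * \<bar>s (fst p)\<bar> ^ DIM('a))"
    using radius_pos[of "fst p"] by (auto simp: k_def indicator_def ball_density_def)
qed simp

lemma norm_kV: "\<theta> \<in> space \<Theta> \<Longrightarrow> norm (k p \<theta> *\<^sub>R V p \<theta>) \<le> B (fst p) * k p \<theta>"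
  using k_nonzeroD(4)[of p \<theta>] k_nonneg[of p \<theta>]
  by (cases "k p \<theta> = 0") (auto intro: mult_left_mono simp: mult.commute)

lemma norm_kV': "\<theta> \<in> space \<Theta> \<Longrightarrow> norm (k p \<theta> *\<^sub>R V p \<theta>) \<le> C * k p \<theta>"
  using norm_kV[of \<theta> p] k_nonzeroD(1,2)[of p \<theta>] speed_bound[of "fst p"] k_nonneg[of p \<theta>]
    mult_right_mono[of "B (fst p)" C "k p \<theta>"]
  by (cases "k p \<theta> = 0") force+

lemma integrable_kV: "integrable (lborel \<Otimes>\<^sub>M \<Theta>) (\<lambda>(p, \<theta>). k p \<theta> *\<^sub>R V p \<theta>)"
  by (rule Bochner_Integration.integrable_bound[OF integrable_mult_right[OF integrable_k, of C]])
    (use norm_kV' C_nonneg in \<open>auto simp: space_pair_measure k_nonneg abs_mult intro!: AE_I2 simp flip: norm_scaleR\<close>)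

lemma integrable_kV_\<theta>: "integrable \<Theta> (\<lambda>\<theta>. k p \<theta> *\<^sub>R V p \<theta>)"
  by (rule Bochner_Integration.integrable_bound[OF integrable_mult_right[OF integrable_k_\<theta>[of p], of C]])
    (use norm_kV'[of _ p] C_nonneg in \<open>auto simp: k_nonneg abs_mult intro!: AE_I2 simp flip: norm_scaleR\<close>)

lemma F_nonneg: "0 \<le> F p"
  unfolding F_def by (simp add: k_nonneg)

lemma integrable_F: "integrable lborel F"
  using PP.integrable_fst[OF integrable_k] unfolding F_def[abs_def] by simp

lemma integrable_J: "integrable lborel J"
  using PP.integrable_fst[OF integrable_kV] unfolding J_def[abs_def] by simp

lemma F_outside:
  assumes "p \<notin> {0..1} \<times> \<Omega>"
  shows "F p = 0"
proof -
  have "k p \<theta> = 0" if "\<theta> \<in> space \<Theta>" for \<theta>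
    using k_nonzeroD(1-3)[OF _ that, of p] assms by (cases p) force
  then show ?thesis by (simp add: F_def cong: Bochner_Integration.integral_cong)
qed

text \<open>A speed bound that is linear in flux and density survives averaging, even where balls of
  different velocities overlap.\<close>

lemma norm_J: "norm (J p) \<le> B (fst p) * F p"
proof -
  have "norm (J p) \<le> (\<integral>\<theta>. B (fst p) * k p \<theta> \<partial>\<Theta>)"
    unfolding J_def
    by (rule order_trans[OF integral_norm_bound]) (intro integral_mono integrable_norm integrable_kV_\<theta>
      integrable_mult_right integrable_k_\<theta> norm_kV)
  then show ?thesis by (simp add: F_def)
qed

lemma integral_F: "(\<integral>p. F p \<partial>lborel) = 1"
proof -
  have "(\<integral>p. F p \<partial>lborel) = (\<integral>\<theta>. \<integral>p. k p \<theta> \<partial>lborel \<partial>\<Theta>)"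
    unfolding F_def using PP.Fubini_integral[OF integrable_k] by simp
  also have "\<dots> = (\<integral>\<theta>. 1 \<partial>\<Theta>)"
    by (intro Bochner_Integration.integral_cong) (auto simp: integral_eq_nn_integral nn_integral_k k_nonneg)
  finally show ?thesis by (simp add: prob_space)
qed

end

section \<open>Derivatives of C^1 functions: measurability and bounds\<close>

lemma frechet_derivative_components:
  fixes \<phi> :: "'b::euclidean_space \<Rightarrow> real"
  assumes "\<phi> differentiable (at z)"
  shows "frechet_derivative \<phi> (at z) v = (\<Sum>b\<in>Basis. (v \<bullet> b) * frechet_derivative \<phi> (at z) b)"
proof -
  have "linear (frechet_derivative \<phi> (at z))"
    using assms by (simp add: linear_frechet_derivative)
  then show ?thesis
    by (subst euclidean_representation[symmetric]) (simp add: linear_sum linear_scale)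
qed

text \<open>Continuity is available in the base point for one fixed direction at a time; expanding
  the direction in the basis lets base point and direction vary jointly.\<close>

lemma frechet_derivative_measurable:
  fixes \<phi> :: "'b::euclidean_space \<Rightarrow> real"
  assumes "\<And>z. \<phi> differentiable (at z)"
    and "\<And>v. continuous_on UNIV (\<lambda>z. frechet_derivative \<phi> (at z) v)"
    and [measurable]: "f \<in> borel_measurable M" "g \<in> borel_measurable M"
  shows "(\<lambda>x. frechet_derivative \<phi> (at (f x)) (g x)) \<in> borel_measurable M"
proof -
  have [measurable]: "(\<lambda>z. frechet_derivative \<phi> (at z) v) \<in> borel_measurable borel" for v
    using assms(2) by (rule borel_measurable_continuous_onI)
  show ?thesis
    by (subst frechet_derivative_components[OF assms(1)]) measurable
qed

lemma frechet_derivative_bounded_on_compact: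
  fixes \<phi> :: "'b::euclidean_space \<Rightarrow> real"
  assumes diff: "\<And>z. \<phi> differentiable (at z)"
    and cont: "\<And>v. continuous_on UNIV (\<lambda>z. frechet_derivative \<phi> (at z) v)"
    and "compact K"
  obtains M where "0 \<le> M" "\<And>z v. z \<in> K \<Longrightarrow> \<bar>frechet_derivative \<phi> (at z) v\<bar> \<le> M * norm v"
proof -
  let ?s = "\<lambda>z. \<Sum>b\<in>Basis. \<bar>frechet_derivative \<phi> (at z) b\<bar>"
  have "continuous_on K ?s"
    by (intro continuous_intros continuous_on_subset[OF cont]) auto
  then have "bounded (?s ` K)"
    using compact_continuous_image \<open>compact K\<close> compact_imp_bounded by blast
  then obtain M where "0 < M" and M: "\<And>z. z \<in> K \<Longrightarrow> \<bar>?s z\<bar> \<le> M"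
    unfolding bounded_pos by auto
  have "\<bar>frechet_derivative \<phi> (at z) v\<bar> \<le> M * norm v" if "z \<in> K" for z v
  proof -
    have "\<bar>frechet_derivative \<phi> (at z) v\<bar> \<le> (\<Sum>b\<in>Basis. \<bar>(v \<bullet> b) * frechet_derivative \<phi> (at z) b\<bar>)"
      by (subst frechet_derivative_components[OF diff]) (rule sum_abs)
    also have "\<dots> \<le> (\<Sum>b\<in>Basis. norm v * \<bar>frechet_derivative \<phi> (at z) b\<bar>)"
      by (intro sum_mono) (auto simp: abs_mult Basis_le_norm intro!: mult_right_mono)
    also have "\<dots> = norm v * ?s z" by (simp add: sum_distrib_left)
    also have "\<dots> \<le> norm v * M" using M[OF that] by (intro mult_left_mono) auto
    finally show ?thesis by (simp add: mult.commute)
  qed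
  with \<open>0 < M\<close> show ?thesis by (intro that[of M]) auto
qed

section \<open>Weak continuity equation for the averaged balls\<close>

context moving_balls
begin

context
  fixes \<phi> :: "real \<times> 'a \<Rightarrow> real"
  assumes diff: "\<And>z. \<phi> differentiable (at z)"
    and cont: "\<And>v. continuous_on UNIV (\<lambda>z. frechet_derivative \<phi> (at z) v)"
begin

abbreviation "d z \<equiv> frechet_derivative \<phi> (at z)"

lemma d_works: "(\<phi> has_derivative d z) (at z)"
  using diff frechet_derivative_works by blast

lemma d_split: "d z (x, y) = x * d z (1, 0) + d z (0, y)"
proof -
  have l: "linear (d z)" using d_works has_derivative_linear by blast
  have "(x, y) = x *\<^sub>R (1, 0) + (0, y)" by simp
  then show ?thesis using linear_add[OF l] linear_scale[OF l] by (metis real_scaleR_def)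
qed

lemmas d_measurable [measurable (raw)] = frechet_derivative_measurable[OF diff cont]

lemma integrable_k_space:
  assumes "\<theta> \<in> space \<Theta>"
  shows "integrable lborel (\<lambda>p. k p \<theta>)"
  using assms by (intro integrableI_nonneg) (auto simp: nn_integral_k k_nonneg)

text \<open>The chain rule along the path of a single particle. Because the radius vanishes at times
  0 and 1, the end values do not depend on the relative position \<open>w\<close>.\<close>

lemma derivative_along_path:
  assumes \<theta>: "\<theta> \<in> space \<Theta>" and w: "w \<in> ball 0 1"
    and C': "\<And>t. t \<in> {0<..<1} \<Longrightarrow> \<bar>d (t, A t \<theta> + s t *\<^sub>R w) (1, A' t \<theta> + s' t *\<^sub>R w)\<bar> \<le> C'"
  shows "(\<integral>t. indicator {0<..<1} t * d (t, A t \<theta> + s t *\<^sub>R w) (1, A' t \<theta> + s' t *\<^sub>R w) \<partial>lborel)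
    = \<phi> (1, A 1 \<theta>) - \<phi> (0, A 0 \<theta>)"
proof -
  let ?g = "\<lambda>t. (t, A t \<theta> + s t *\<^sub>R w)"
  have "(\<integral>t. indicator {0<..<1} t * d (?g t) (1, A' t \<theta> + s' t *\<^sub>R w) \<partial>lborel) = \<phi> (?g 1) - \<phi> (?g 0)"
  proof (rule integral_deriv_unit_interval[OF finite_S])
    have "continuous_on UNIV \<phi>"
      using diff by (simp add: differentiable_imp_continuous_on differentiable_on_def differentiable_at_withinI)
    then have "continuous_on (?g ` {0..1}) \<phi>"
      using continuous_on_subset by blast
    then show "continuous_on {0..1} (\<lambda>t. \<phi> (?g t))"
      by (rule continuous_on_compose2) (auto intro!: continuous_intros center_continuous[OF \<theta>] radius_continuous)
  next
    fix t assume t: "t \<in> {0<..<1} - S"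
    have g: "(?g has_vector_derivative (1, A' t \<theta> + s' t *\<^sub>R w)) (at t)"
      by (auto intro!: derivative_eq_intros has_vector_derivative_Pair center_deriv[OF t \<theta>]
        radius_deriv[OF t, folded has_real_derivative_iff_has_vector_derivative])
    have l: "linear (d (?g t))" using d_works has_derivative_linear by blast
    have "((\<lambda>t. \<phi> (?g t)) has_derivative (\<lambda>x. d (?g t) (x *\<^sub>R (1, A' t \<theta> + s' t *\<^sub>R w)))) (at t)"
      using has_derivative_compose[OF g[unfolded has_vector_derivative_def] d_works] .
    then show "((\<lambda>t. \<phi> (?g t)) has_vector_derivative d (?g t) (1, A' t \<theta> + s' t *\<^sub>R w)) (at t)"
      unfolding has_vector_derivative_def linear_scale[OF l] .
  next
    show "(\<lambda>t. d (?g t) (1, A' t \<theta> + s' t *\<^sub>R w)) \<in> borel_measurable borel"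
      unfolding borel_prod[symmetric] using \<theta> by measurable
  qed (rule C')
  then show ?thesis by (simp add: radius_ends)
qed

text \<open>The particles stay in the compact set [0,1] \<times> closure \<Omega> and have speed at
  most \<open>C\<close>, so one constant dominates the derivative both along a path and at a point
  covered by a ball. Both forms serve as majorants for Fubini.\<close>

lemma d_along_bound:
  obtains C' where "0 \<le> C'"
    "\<And>t \<theta> w. t \<in> {0<..<1} \<Longrightarrow> \<theta> \<in> space \<Theta> \<Longrightarrow> w \<in> ball 0 1 \<Longrightarrow>
      \<bar>d (t, A t \<theta> + s t *\<^sub>R w) (1, A' t \<theta> + s' t *\<^sub>R w)\<bar> \<le> C'"
    "\<And>p \<theta>. \<theta> \<in> space \<Theta> \<Longrightarrow> norm (k p \<theta> * d p (1, V p \<theta>)) \<le> C' * k p \<theta>"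
proof -
  have "compact ({0..1::real} \<times> closure \<Omega>)"
    using bounded_domain by (simp add: compact_Times)
  from frechet_derivative_bounded_on_compact[OF diff cont this]
  obtain M where "0 \<le> M" and M: "\<And>z v. z \<in> {0..1} \<times> closure \<Omega> \<Longrightarrow> \<bar>d z v\<bar> \<le> M * norm v"
    by blast
  have M1: "\<bar>d (t, x) (1, v)\<bar> \<le> M * (1 + C)" if "t \<in> {0<..<1}" "x \<in> \<Omega>" "norm v \<le> C" for t x v
  proof -
    have "\<bar>d (t, x) (1, v)\<bar> \<le> M * norm (1::real, v)"
      using that closure_subset by (intro M) auto
    also have "\<dots> \<le> M * (1 + C)"
      using norm_Pair_le[of "1::real" v] that \<open>0 \<le> M\<close> by (intro mult_left_mono) auto
    finally show ?thesis .
  qed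
  show ?thesis
  proof (rule that[of "M * (1 + C)"])
    show "0 \<le> M * (1 + C)" using C_nonneg \<open>0 \<le> M\<close> by simp
    show "\<bar>d (t, A t \<theta> + s t *\<^sub>R w) (1, A' t \<theta> + s' t *\<^sub>R w)\<bar> \<le> M * (1 + C)"
      if t: "t \<in> {0<..<1}" and \<theta>: "\<theta> \<in> space \<Theta>" and w: "w \<in> ball 0 1" for t \<theta> w
    proof (rule M1[OF t])
      have "A t \<theta> + s t *\<^sub>R w \<in> ball (A t \<theta>) (s t)"
        using w radius_pos[OF t] by (simp add: dist_norm)
      then show "A t \<theta> + s t *\<^sub>R w \<in> \<Omega>" using inside[OF t \<theta>] by blast
      show "norm (A' t \<theta> + s' t *\<^sub>R w) \<le> C"
        using speed[OF t \<theta> w] speed_bound[OF t] by simp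
    qed
    show "norm (k p \<theta> * d p (1, V p \<theta>)) \<le> M * (1 + C) * k p \<theta>" if \<theta>: "\<theta> \<in> space \<Theta>" for p \<theta>
    proof (cases "k p \<theta> = 0")
      case False
      note z = k_nonzeroD[OF False \<theta>]
      have "\<bar>d (fst p, snd p) (1, V p \<theta>)\<bar> \<le> M * (1 + C)"
        using z speed_bound[of "fst p"] by (intro M1) auto
      then show ?thesis
        using mult_left_mono[of _ _ "k p \<theta>"] k_nonneg[of p \<theta>] by (simp add: abs_mult mult.commute[of _ "k p \<theta>"])
    qed simp
  qed
qed

lemma integrable_kd: "integrable (lborel \<Otimes>\<^sub>M \<Theta>) (\<lambda>(p, \<theta>). k p \<theta> * d p (1, V p \<theta>))"
proof -
  obtain C' where "0 \<le> C'" and "\<And>p \<theta>. \<theta> \<in> space \<Theta> \<Longrightarrow> norm (k p \<theta> * d p (1, V p \<theta>)) \<le> C' * k p \<theta>"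
    using d_along_bound by metis
  then show ?thesis
    by (intro Bochner_Integration.integrable_bound[OF integrable_mult_right[OF integrable_k, of C']])
      (auto simp: space_pair_measure k_nonneg abs_mult intro!: AE_I2)
qed

text \<open>The derivative is linear in its direction, so averaging \<open>k\<close> times the
  direction (1, \<open>V\<close>) produces the direction (\<open>F\<close>,
  \<open>J\<close>).\<close>

lemma integral_kd_\<theta>:
  "(\<integral>\<theta>. k p \<theta> * d p (1, V p \<theta>) \<partial>\<Theta>) = F p * d p (1, 0) + d p (0, J p)"
proof -
  have bl: "bounded_linear (\<lambda>v. d p (0, v))"
    using bounded_linear_compose[OF has_derivative_bounded_linear[OF d_works]
        bounded_linear_Pair[OF bounded_linear_zero bounded_linear_ident]] .
  have "(\<integral>\<theta>. k p \<theta> * d p (1, V p \<theta>) \<partial>\<Theta>) = (\<integral>\<theta>. k p \<theta> * d p (1, 0) + d p (0, k p \<theta> *\<^sub>R V p \<theta>) \<partial>\<Theta>)"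
    by (subst d_split) (simp add: distrib_left linear_scale[OF bounded_linear.linear[OF bl]])
  also have "\<dots> = (\<integral>\<theta>. k p \<theta> * d p (1, 0) \<partial>\<Theta>) + (\<integral>\<theta>. d p (0, k p \<theta> *\<^sub>R V p \<theta>) \<partial>\<Theta>)"
    by (intro Bochner_Integration.integral_add integrable_mult_left integrable_k_\<theta>
        integrable_bounded_linear[OF bl] integrable_kV_\<theta>)
  also have "(\<integral>\<theta>. d p (0, k p \<theta> *\<^sub>R V p \<theta>) \<partial>\<Theta>) = d p (0, J p)"
    unfolding J_def by (rule integral_bounded_linear[OF bl integrable_kV_\<theta>])
  finally show ?thesis by (simp add: F_def)
qed

lemma integrable_weak_form: "integrable lborel (\<lambda>p. F p * d p (1, 0) + d p (0, J p))"
  using PP.integrable_fst[OF integrable_kd] by (simp add: integral_kd_\<theta>)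

text \<open>With the relative position \<open>w\<close> held fixed, the integrand is the total time
  derivative of the test along a path; after interchanging the integrals only the end values
  remain.\<close>

lemma integral_kd_p:
  assumes \<theta>: "\<theta> \<in> space \<Theta>"
  shows "(\<integral>p. k p \<theta> * d p (1, V p \<theta>) \<partial>lborel) = \<phi> (1, A 1 \<theta>) - \<phi> (0, A 0 \<theta>)"
proof -
  obtain C' where "0 \<le> C'"
    and C': "\<And>t \<theta> w. t \<in> {0<..<1} \<Longrightarrow> \<theta> \<in> space \<Theta> \<Longrightarrow> w \<in> ball 0 1 \<Longrightarrow>
      \<bar>d (t, A t \<theta> + s t *\<^sub>R w) (1, A' t \<theta> + s' t *\<^sub>R w)\<bar> \<le> C'"
    and C'k: "\<And>p \<theta>. \<theta> \<in> space \<Theta> \<Longrightarrow> norm (k p \<theta> * d p (1, V p \<theta>)) \<le> C' * k p \<theta>"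
    using d_along_bound by metis
  let ?e = "\<lambda>t w. d (t, A t \<theta> + s t *\<^sub>R w) (1, A' t \<theta> + s' t *\<^sub>R w)"
  let ?b = "\<lambda>(t::real) w::'a. indicator {0<..<1} t * ball_density 0 1 w"
  have int: "integrable lborel (\<lambda>p. k p \<theta> * d p (1, V p \<theta>))"
    by (rule Bochner_Integration.integrable_bound[OF integrable_mult_right[OF integrable_k_space[OF \<theta>], of C']])
      (use \<theta> C'k[OF \<theta>] \<open>0 \<le> C'\<close> in \<open>auto simp: k_nonneg abs_mult intro!: AE_I2\<close>)
  have "(\<integral>p. k p \<theta> * d p (1, V p \<theta>) \<partial>lborel) =
      (\<integral>t. \<integral>z. k (t, z) \<theta> * d (t, z) (1, V (t, z) \<theta>) \<partial>lborel \<partial>lborel)"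
    using lborel_pair.integral_fst'[of "\<lambda>p. k p \<theta> * d p (1, V p \<theta>)"] int by (simp add: lborel_prod)
  also have "\<dots> = (\<integral>t. \<integral>w. ?b t w * ?e t w \<partial>lborel \<partial>lborel)"
  proof (rule Bochner_Integration.integral_cong[OF refl])
    fix t :: real
    show "(\<integral>z. k (t, z) \<theta> * d (t, z) (1, V (t, z) \<theta>) \<partial>lborel) = (\<integral>w. ?b t w * ?e t w \<partial>lborel)"
    proof (cases "t \<in> {0<..<1}")
      case True
      have "(\<integral>z. k (t, z) \<theta> * d (t, z) (1, V (t, z) \<theta>) \<partial>lborel) =
          (\<integral>z. ball_density (A t \<theta>) (s t) z * d (t, z) (1, V (t, z) \<theta>) \<partial>lborel)"
        using True by (simp add: k_def)
      also have "\<dots> = (\<integral>w. ball_density 0 1 w * d (t, A t \<theta> + s t *\<^sub>R w) (1, V (t, A t \<theta> + s t *\<^sub>R w) \<theta>) \<partial>lborel)"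
      proof (rule integral_ball_density[OF radius_pos[OF True]])
        have "(\<lambda>z. V (t, z) \<theta>) \<in> borel_measurable borel"
          unfolding V_def using \<theta> by simp
        then show "(\<lambda>z. d (t, z) (1, V (t, z) \<theta>)) \<in> borel_measurable borel"
          by (intro d_measurable borel_measurable_Pair) auto
      qed
      finally show ?thesis using True radius_pos[OF True] by (simp add: V_def)
    qed (simp add: k_def)
  qed
  \<comment> \<open>The majorant is \<open>C'\<close> times a product density on (0,1) \<times> unit
    ball, which carries total mass 1.\<close>
  also have "\<dots> = (\<integral>w. \<integral>t. ?b t w * ?e t w \<partial>lborel \<partial>lborel)"
  proof (rule lborel_pair.Fubini_integral[symmetric])
    have "integrable (lborel \<Otimes>\<^sub>M lborel) (\<lambda>(t, w). ?b t w)"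
    proof (rule integrableI_nonneg)
      have "(\<lambda>(t, w). ennreal (?b t w)) \<in> borel_measurable (lborel \<Otimes>\<^sub>M lborel)"
        by measurable
      from lborel.nn_integral_fst[OF this]
      have "(\<integral>\<^sup>+x. ennreal (case x of (t, w) \<Rightarrow> ?b t w) \<partial>(lborel \<Otimes>\<^sub>M lborel)) =
          (\<integral>\<^sup>+t. \<integral>\<^sup>+w. ennreal (?b t w) \<partial>lborel \<partial>lborel)"
        by (simp add: case_prod_unfold)
      also have "\<dots> = (\<integral>\<^sup>+t. indicator {0<..<1::real} t \<partial>lborel)"
        by (intro nn_integral_cong) (auto simp: indicator_def nn_integral_ball_density)
      finally show "(\<integral>\<^sup>+x. ennreal (case x of (t, w) \<Rightarrow> ?b t w) \<partial>(lborel \<Otimes>\<^sub>M lborel)) < \<infinity>" by simp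
    qed (auto simp: ball_density_nonneg)
    then show "integrable (lborel \<Otimes>\<^sub>M lborel) (\<lambda>(t, w). ?b t w * ?e t w)"
    proof (rule Bochner_Integration.integrable_bound[OF integrable_mult_right[of C']])
      show "(\<lambda>(t, w). ?b t w * ?e t w) \<in> borel_measurable (lborel \<Otimes>\<^sub>M lborel)"
        using \<theta> by (simp add: borel_prod[symmetric] del: borel_prod)
      show "AE x in lborel \<Otimes>\<^sub>M lborel. norm (case x of (t, w) \<Rightarrow> ?b t w * ?e t w) \<le> norm (C' * (case x of (t, w) \<Rightarrow> ?b t w))"
      proof (intro AE_I2, clarify)
        fix t and w :: 'a
        show "norm (?b t w * ?e t w) \<le> norm (C' * ?b t w)"
        proof (cases "t \<in> {0<..<1} \<and> w \<in> ball 0 1")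
          case True
          then have "\<bar>?e t w\<bar> \<le> C'" using C'[OF _ \<theta>] by blast
          then show ?thesis using True \<open>0 \<le> C'\<close>
            by (simp add: abs_mult mult.commute[of C'] mult_left_mono)
        qed (auto simp: ball_density_def indicator_def)
      qed
    qed
  qed
  also have "\<dots> = (\<integral>w. ball_density 0 1 (w::'a) * (\<phi> (1, A 1 \<theta>) - \<phi> (0, A 0 \<theta>)) \<partial>lborel)"
  proof (rule Bochner_Integration.integral_cong[OF refl])
    fix w :: 'a
    have "(\<integral>t. ?b t w * ?e t w \<partial>lborel) = ball_density 0 1 w * (\<integral>t. indicator {0<..<1} t * ?e t w \<partial>lborel)"
      by (simp add: mult.assoc mult.left_commute[of "indicator _ _"])
    also have "\<dots> = ball_density 0 1 w * (\<phi> (1, A 1 \<theta>) - \<phi> (0, A 0 \<theta>))"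
    proof (cases "w \<in> ball 0 1")
      case True
      show ?thesis by (subst derivative_along_path[OF \<theta> True C'[OF _ \<theta> True]]) auto
    qed (simp add: ball_density_def)
    finally show "(\<integral>t. ?b t w * ?e t w \<partial>lborel) = ball_density 0 1 w * (\<phi> (1, A 1 \<theta>) - \<phi> (0, A 0 \<theta>))" .
  qed
  also have "\<dots> = \<phi> (1, A 1 \<theta>) - \<phi> (0, A 0 \<theta>)"
    by (simp add: integral_eq_nn_integral ball_density_nonneg nn_integral_ball_density)
  finally show ?thesis .
qed

text \<open>One double integral in two orders: over \<theta> first it gives the Eulerian weak form,
  over space-time first the difference of the end values of each ball.\<close>

lemma weak_form:
  "(\<integral>p. F p * d p (1, 0) + d p (0, J p) \<partial>lborel) = (\<integral>\<theta>. \<phi> (1, A 1 \<theta>) - \<phi> (0, A 0 \<theta>) \<partial>\<Theta>)"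
proof -
  have "(\<integral>p. F p * d p (1, 0) + d p (0, J p) \<partial>lborel) = (\<integral>\<theta>. \<integral>p. k p \<theta> * d p (1, V p \<theta>) \<partial>lborel \<partial>\<Theta>)"
    using PP.Fubini_integral[OF integrable_kd] by (simp add: integral_kd_\<theta>)
  also have "\<dots> = (\<integral>\<theta>. \<phi> (1, A 1 \<theta>) - \<phi> (0, A 0 \<theta>) \<partial>\<Theta>)"
    by (intro Bochner_Integration.integral_cong) (auto simp: integral_kd_p)
  finally show ?thesis .
qed

end

end

section \<open>Cells of a Lipschitz domain\<close>

text \<open>At a boundary point p, shift inward to q = p + h e. On the way from x to y the
  horizontal displacement comes only from the errors y - q and p - x, while the height grows by
  about h. For balls of radius \<rho> small against h / (1 + L) the segment therefore climbs faster
  than the Lipschitz graph can.\<close>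

lemma lipschitz_boundary_locally_star_shaped:
  fixes \<Omega> :: "'a::euclidean_space set"
  assumes "open \<Omega>" "lipschitz_boundary \<Omega>" "p \<in> closure \<Omega>" "0 < \<epsilon>"
  obtains q \<kappa> \<rho> where "0 < \<kappa>" "0 < \<rho>" "q \<in> \<Omega>"
    "\<And>x y. x \<in> \<Omega> \<inter> ball p \<rho> \<Longrightarrow> y \<in> ball q \<kappa> \<Longrightarrow> dist x y \<le> \<epsilon> \<and> closed_segment x y \<subseteq> \<Omega>"
proof (cases "p \<in> \<Omega>")
  case True
  then obtain r where r: "0 < r" "ball p r \<subseteq> \<Omega>" using \<open>open \<Omega>\<close> open_contains_ball by blast
  let ?r = "min r (\<epsilon> / 2)"
  show ?thesis
  proof (rule that[of ?r ?r p])
    fix x y assume "x \<in> \<Omega> \<inter> ball p ?r" "y \<in> ball p ?r"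
    then have *: "x \<in> ball p ?r" "y \<in> ball p ?r" by auto
    then have "closed_segment x y \<subseteq> ball p ?r" by (simp add: closed_segment_subset)
    moreover have "ball p ?r \<subseteq> ball p r" by auto
    moreover have "dist x y \<le> \<epsilon>" using * dist_triangle3[of x y p] by auto
    ultimately show "dist x y \<le> \<epsilon> \<and> closed_segment x y \<subseteq> \<Omega>" using r by blast
  qed (use True r \<open>0 < \<epsilon>\<close> in auto)
next
  case False
  then have "p \<in> frontier \<Omega>" using assms by (simp add: frontier_def interior_open)
  then obtain e r L \<gamma> where e: "norm e = 1" and r: "0 < r" and L: "L-lipschitz_on {y. y \<bullet> e = 0} \<gamma>"
    and \<Omega>: "\<Omega> \<inter> ball p r = {x \<in> ball p r. \<gamma> (x - (x \<bullet> e) *\<^sub>R e) < x \<bullet> e}"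
    using bspec[OF \<open>lipschitz_boundary \<Omega>\<close>[unfolded lipschitz_boundary_def] \<open>p \<in> frontier \<Omega>\<close>]
    by (elim exE conjE) rule
  have ee: "e \<bullet> e = 1" using e by (simp add: norm_eq_1)
  have "0 \<le> L" using L lipschitz_on_nonneg by blast
  \<comment> \<open>\<open>h\<close> is small enough to keep all segments in the chart ball and
    shorter than \<epsilon>. The choice 4 (1 + L) \<rho> = h gives 2 L \<rho> \<le> h - 2 \<rho>,
    that is, the greatest rise of the graph is at most the least climb of the segment.\<close>
  define h where "h = min r \<epsilon> / 4"
  define \<rho> where "\<rho> = h / (4 * (1 + L))"
  have h: "0 < h" "4 * h \<le> r" "4 * h \<le> \<epsilon>" using r \<open>0 < \<epsilon>\<close> by (auto simp: h_def)
  have \<rho>: "0 < \<rho>" "4 * ((1 + L) * \<rho>) = h" using h \<open>0 \<le> L\<close> by (auto simp: \<rho>_def field_simps)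
  have "\<rho> \<le> (1 + L) * \<rho>" using \<rho> \<open>0 \<le> L\<close> by (simp add: algebra_simps)
  then have \<rho>h: "4 * \<rho> \<le> h" using \<rho> by linarith
  let ?q = "p + h *\<^sub>R e"
  let ?P = "\<lambda>x. x - (x \<bullet> e) *\<^sub>R e"
  have P0: "?P x \<bullet> e = 0" for x by (simp add: inner_diff_left ee)
  have Pd: "?P x - ?P y = ?P (x - y)" for x y by (simp add: inner_diff_left scaleR_diff_left)
  have Ps: "?P (s *\<^sub>R x) = s *\<^sub>R ?P x" for s x by (simp add: scaleR_diff_right)
  have Pn: "norm (?P x) \<le> norm x" for x
  proof -
    have "(norm (?P x))\<^sup>2 = (norm x)\<^sup>2 - (x \<bullet> e)\<^sup>2"
      unfolding power2_norm_eq_inner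
      by (simp add: inner_diff_left inner_diff_right ee inner_commute power2_eq_square)
    then have "(norm (?P x))\<^sup>2 \<le> (norm x)\<^sup>2" using zero_le_power2[of "x \<bullet> e"] by linarith
    then show ?thesis by (rule power2_le_imp_le) (rule norm_ge_zero)
  qed
  have main: "dist x y \<le> \<epsilon> \<and> closed_segment x y \<subseteq> \<Omega>"
    if x: "x \<in> \<Omega> \<inter> ball p \<rho>" and y: "y \<in> ball ?q \<rho>" for x y
  proof
    have px: "norm (p - x) < \<rho>" and yq: "norm (y - ?q) < \<rho>"
      using x y by (auto simp: dist_norm norm_minus_commute)
    have yx: "y - x = (y - ?q) + (p - x) + h *\<^sub>R e" by simp
    have "norm (y - x) \<le> norm (y - ?q) + norm (p - x) + norm (h *\<^sub>R e)"
      using norm_triangle_ineq[of "(y - ?q) + (p - x)" "h *\<^sub>R e"] norm_triangle_ineq[of "y - ?q" "p - x"]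
      unfolding yx[symmetric] by linarith
    then show "dist x y \<le> \<epsilon>"
      using px yq h \<rho>h e by (simp add: dist_norm norm_minus_commute)
    have yp: "norm (y - p) < r"
      using norm_triangle_ineq[of "y - ?q" "h *\<^sub>R e"] yq \<rho>h h e by simp
    have xr: "x \<in> ball p r" "y \<in> ball p r"
      using px yp \<rho>h h by (auto simp: dist_norm norm_minus_commute)
    show "closed_segment x y \<subseteq> \<Omega>"
    proof
      fix z assume z: "z \<in> closed_segment x y"
      then have zr: "z \<in> ball p r"
        using xr closed_segment_subset[of x "ball p r" y] by auto
      from z obtain s where s: "0 \<le> s" "s \<le> 1" and "z = (1 - s) *\<^sub>R x + s *\<^sub>R y"
        by (auto simp: in_segment)
      then have zx: "z - x = s *\<^sub>R (y - x)" by (simp add: algebra_simps)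
      let ?u = "(y - ?q) + (p - x)"
      have nu: "norm ?u \<le> 2 * \<rho>" using norm_triangle_ineq[of "y - ?q" "p - x"] px yq by linarith
      have "?P z - ?P x = s *\<^sub>R ?P (y - x)"
        using Pd[of z x] Ps[of s "y - x"] zx by simp
      also have "?P (y - x) = ?P ?u"
        by (subst yx) (simp only: inner_add_left inner_scaleR_left ee scaleR_add_left, simp)
      finally have "norm (?P z - ?P x) = s * norm (?P ?u)" using s by simp
      also have "\<dots> \<le> s * (2 * \<rho>)" using Pn[of ?u] nu s by (intro mult_left_mono) auto
      finally have "dist (?P z) (?P x) \<le> s * (2 * \<rho>)" by (simp add: dist_norm)
      moreover have "dist (\<gamma> (?P z)) (\<gamma> (?P x)) \<le> L * dist (?P z) (?P x)"
        using L P0 by (intro lipschitz_onD) auto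
      ultimately have "dist (\<gamma> (?P z)) (\<gamma> (?P x)) \<le> L * (s * (2 * \<rho>))"
        using \<open>0 \<le> L\<close> by (meson mult_left_mono order_trans)
      then have 1: "\<gamma> (?P z) \<le> \<gamma> (?P x) + L * (s * (2 * \<rho>))" by (simp add: dist_real_def)
      have "x \<in> \<Omega> \<inter> ball p r" using x xr by blast
      then have 2: "\<gamma> (?P x) < x \<bullet> e" unfolding \<Omega> by simp
      have "z \<bullet> e = x \<bullet> e + s * ((y - x) \<bullet> e)"
        using arg_cong[OF zx, of "\<lambda>v. v \<bullet> e"] by (simp add: inner_diff_left)
      also have "(y - x) \<bullet> e = ?u \<bullet> e + h" by (simp add: inner_diff_left inner_add_left ee)
      finally have 3: "z \<bullet> e = x \<bullet> e + s * (?u \<bullet> e + h)" .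
      have "- (2 * \<rho>) \<le> ?u \<bullet> e" using Cauchy_Schwarz_ineq2[of ?u e] e nu by simp
      moreover have "4 * \<rho> + 4 * (L * \<rho>) = h" using \<rho>(2) by (simp add: distrib_right)
      moreover have "0 \<le> L * \<rho>" using \<open>0 \<le> L\<close> \<rho>(1) by simp
      ultimately have "L * (2 * \<rho>) \<le> ?u \<bullet> e + h" using \<rho>(1) unfolding mult.left_commute[of L 2] by linarith
      then have "s * (L * (2 * \<rho>)) \<le> s * (?u \<bullet> e + h)" using s by (intro mult_left_mono) auto
      then have "\<gamma> (?P z) < z \<bullet> e" using 1 2 3 by (simp add: mult.left_commute)
      then have "z \<in> {x \<in> ball p r. \<gamma> (?P x) < x \<bullet> e}" using zr by simp
      then show "z \<in> \<Omega>" unfolding \<Omega>[symmetric] by simp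
    qed
  qed
  \<comment> \<open>\<open>p\<close> itself lies only in the closure, but some point of \<Omega> is
    near it, and \<open>?q\<close> is the end of a segment from that point.\<close>
  obtain x where x: "x \<in> \<Omega> \<inter> ball p \<rho>"
    using assms(3) \<rho>(1) unfolding closure_approachable by (auto simp: dist_commute)
  have "?q \<in> closed_segment x ?q" by simp
  then have "?q \<in> \<Omega>" using main[OF x, of ?q] \<rho>(1) by auto
  then show ?thesis using that[of \<rho> \<rho> ?q] main \<rho>(1) by blast
qed

lemma lipschitz_domain_cells:
  fixes \<Omega> :: "'a::euclidean_space set"
  assumes "open \<Omega>" "bounded \<Omega>" "lipschitz_boundary \<Omega>" "0 < \<epsilon>"
  obtains n :: nat and q :: "nat \<Rightarrow> 'a" and c \<kappa> where "0 < \<kappa>"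
    "c \<in> borel \<rightarrow>\<^sub>M count_space UNIV" "\<And>x. x \<in> \<Omega> \<Longrightarrow> c x < n" "\<And>i. i < n \<Longrightarrow> q i \<in> \<Omega>"
    "\<And>x y. x \<in> \<Omega> \<Longrightarrow> y \<in> ball (q (c x)) \<kappa> \<Longrightarrow> dist x y \<le> \<epsilon> \<and> closed_segment x y \<subseteq> \<Omega>"
proof -
  define cell where "cell p d \<longleftrightarrow> (case d of (q, \<kappa>, \<rho>) \<Rightarrow> 0 < \<kappa> \<and> 0 < \<rho> \<and> q \<in> \<Omega> \<and>
    (\<forall>x\<in>\<Omega> \<inter> ball p \<rho>. \<forall>y\<in>ball q \<kappa>. dist x y \<le> \<epsilon> \<and> closed_segment x y \<subseteq> \<Omega>))" for p d
  have "\<exists>d. cell p d" if "p \<in> closure \<Omega>" for p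
  proof (rule lipschitz_boundary_locally_star_shaped[OF assms(1,3) that assms(4)])
    fix q \<kappa> \<rho> assume *: "0 < \<kappa>" "0 < \<rho>" "q \<in> \<Omega>"
      "\<And>x y. x \<in> \<Omega> \<inter> ball p \<rho> \<Longrightarrow> y \<in> ball q \<kappa> \<Longrightarrow> dist x y \<le> \<epsilon> \<and> closed_segment x y \<subseteq> \<Omega>"
    have "cell p (q, \<kappa>, \<rho>)" unfolding cell_def using * by auto
    then show ?thesis ..
  qed
  then obtain d where "\<And>p. p \<in> closure \<Omega> \<Longrightarrow> cell p (d p)" by metis
  moreover define Q K R where "Q = (\<lambda>p. fst (d p))" and "K = (\<lambda>p. fst (snd (d p)))" and "R = (\<lambda>p. snd (snd (d p)))"
  ultimately have K: "\<And>p. p \<in> closure \<Omega> \<Longrightarrow> 0 < K p" and R: "\<And>p. p \<in> closure \<Omega> \<Longrightarrow> 0 < R p"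
    and Q: "\<And>p. p \<in> closure \<Omega> \<Longrightarrow> Q p \<in> \<Omega>"
    and star: "\<And>p x y. p \<in> closure \<Omega> \<Longrightarrow> x \<in> \<Omega> \<Longrightarrow> x \<in> ball p (R p) \<Longrightarrow> y \<in> ball (Q p) (K p) \<Longrightarrow>
      dist x y \<le> \<epsilon> \<and> closed_segment x y \<subseteq> \<Omega>"
    unfolding cell_def by (simp_all add: case_prod_unfold)
  have "compact (closure \<Omega>)" using assms(2) by simp
  moreover have "closure \<Omega> \<subseteq> (\<Union>p\<in>closure \<Omega>. ball p (R p))" using R by force
  ultimately obtain P where P: "P \<subseteq> closure \<Omega>" "finite P" "closure \<Omega> \<subseteq> (\<Union>p\<in>P. ball p (R p))"
    using compactE_image[of "closure \<Omega>" "closure \<Omega>" "\<lambda>p. ball p (R p)"] by (metis open_ball)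
  obtain h where h: "bij_betw h {0..<card P} P" using ex_bij_betw_nat_finite[OF P(2)] by blast
  \<comment> \<open>Taking the least index of a covering ball turns the overlapping cover into a
    Borel partition of \<Omega>.\<close>
  define c where "c = (\<lambda>x. LEAST i. i < card P \<and> dist (h i) x < R (h i))"
  have hP: "h i \<in> closure \<Omega>" if "i < card P" for i
    using h that P(1) by (auto dest!: bij_betw_apply)
  have c: "c x < card P \<and> dist (h (c x)) x < R (h (c x))" if x: "x \<in> \<Omega>" for x
  proof -
    obtain p where "p \<in> P" "dist p x < R p" using P(3) closure_subset x by force
    then have "\<exists>i. i < card P \<and> dist (h i) x < R (h i)"
      using h by (metis atLeastLessThan_iff bij_betw_imp_surj_on imageE)
    then show ?thesis unfolding c_def by (rule LeastI_ex)
  qed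
  \<comment> \<open>The inserted 1 keeps the minimum defined if the cover is empty.\<close>
  define \<kappa> where "\<kappa> = Min (insert 1 (K ` P))"
  have \<kappa>: "\<kappa> \<le> K (h i)" if "i < card P" for i
    unfolding \<kappa>_def using P(2) h that by (intro Min_le) (auto dest!: bij_betw_apply)
  show ?thesis
  proof (rule that[of \<kappa> c "card P" "\<lambda>i. Q (h i)"])
    show "0 < \<kappa>" unfolding \<kappa>_def using P(1,2) K by (subst Min_gr_iff) auto
    show "c \<in> borel \<rightarrow>\<^sub>M count_space UNIV" unfolding c_def by measurable
    show "dist x y \<le> \<epsilon> \<and> closed_segment x y \<subseteq> \<Omega>" if "x \<in> \<Omega>" "y \<in> ball (Q (h (c x))) \<kappa>" for x y
      using star[OF hP, of "c x" x y] c[OF that(1)] \<kappa>[of "c x"] that by auto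
  qed (use c Q hP in auto)
qed

text \<open>A polynomial path has a continuous velocity, which is bounded on [0,1]; the tube radius
  comes from separating its compact image from the complement of \<Omega>.\<close>

lemma connected_open_smooth_path:
  fixes \<Omega> :: "'a::euclidean_space set"
  assumes "open \<Omega>" "connected \<Omega>" "x \<in> \<Omega>" "y \<in> \<Omega>"
  obtains g g' D \<kappa> where "g 0 = x" "g 1 = y"
    "\<And>t. (g has_vector_derivative g' t) (at t)" "continuous_on UNIV g'"
    "0 < \<kappa>" "\<And>t. t \<in> {0..1::real} \<Longrightarrow> norm (g' t) \<le> D \<and> ball (g t) \<kappa> \<subseteq> \<Omega>"
proof -
  obtain g where g: "polynomial_function g" "path_image g \<subseteq> \<Omega>" "pathstart g = x" "pathfinish g = y"
    using connected_open_polynomial_connected[OF assms] by blast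
  obtain g' where g': "polynomial_function g'" "\<And>t. (g has_vector_derivative g' t) (at t)"
    using has_vector_derivative_polynomial_function[OF g(1)] by blast
  have cont: "continuous_on UNIV g'" using g'(1) by (rule continuous_on_polymonial_function)
  then have "compact (g' ` {0..1})"
    by (intro compact_continuous_image) (auto intro: continuous_on_subset)
  from compact_imp_bounded[OF this] obtain D where "\<forall>v\<in>g' ` {0..1}. norm v \<le> D"
    unfolding bounded_iff by blast
  then have D: "\<And>t. t \<in> {0..1} \<Longrightarrow> norm (g' t) \<le> D" by simp
  have "path g" using g(1) by (simp add: path_def continuous_on_polymonial_function)
  then have "compact (path_image g)" "path_image g \<noteq> {}" by (auto simp: compact_path_image)
  then obtain \<kappa> where \<kappa>: "0 < \<kappa>" "{z. infdist z (path_image g) \<le> \<kappa>} \<subseteq> \<Omega>"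
    using compact_in_open_separated[OF _ _ assms(1) g(2)] by blast
  have "ball (g t) \<kappa> \<subseteq> \<Omega>" if "t \<in> {0..1}" for t
  proof
    fix z assume z: "z \<in> ball (g t) \<kappa>"
    have "g t \<in> path_image g" using that by (simp add: path_image_def)
    from infdist_le[OF this, of z] z have "infdist z (path_image g) \<le> \<kappa>" by (simp add: dist_commute)
    then show "z \<in> \<Omega>" using \<kappa> by blast
  qed
  then show ?thesis
    using that[of g g' \<kappa> D] g(3,4) g'(2) cont \<kappa>(1) D by (simp add: pathstart_def pathfinish_def)
qed

section \<open>Transport by contraction, travel and expansion\<close>

text \<open>\<eta> is the least positive probability of a value of \<open>X\<close>, hence
  independent of \<open>f\<close> and \<open>h\<close>: either \<open>f\<close> vanishes on all
  values of positive probability, or it equals \<open>h\<close> on one of them. In the application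
  \<open>h\<close> is the height of a ball, so \<eta> is known before the radius is chosen.\<close>

lemma (in prob_space) finitely_valued_dichotomy:
  assumes X [measurable]: "X \<in> M \<rightarrow>\<^sub>M count_space UNIV" and "finite I" "\<And>\<theta>. \<theta> \<in> space M \<Longrightarrow> X \<theta> \<in> I"
  obtains \<eta> where "0 < \<eta>" "\<And>(f :: 'i \<Rightarrow> real) h. 0 \<le> h \<Longrightarrow> (\<And>i. f i = 0 \<or> f i = h) \<Longrightarrow>
    (\<integral>\<theta>. f (X \<theta>) \<partial>M) = 0 \<or> \<eta> * h \<le> (\<integral>\<theta>. f (X \<theta>) \<partial>M)"
proof -
  define P where "P i = prob {\<theta> \<in> space M. X \<theta> = i}" for i
  define \<eta> where "\<eta> = Min (insert 1 (P ` {i \<in> I. P i \<noteq> 0}))"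
  have fin: "finite (insert 1 (P ` {i \<in> I. P i \<noteq> 0}))" using \<open>finite I\<close> by simp
  have "0 < \<eta>" unfolding \<eta>_def using fin
    by (subst Min_gr_iff) (auto simp: P_def zero_less_measure_iff)
  have \<eta>: "\<eta> \<le> P i" if "i \<in> I" "P i \<noteq> 0" for i
    unfolding \<eta>_def using fin that by (intro Min_le) auto
  show ?thesis
  proof (rule that[OF \<open>0 < \<eta>\<close>])
    fix f :: "'i \<Rightarrow> real" and h assume h: "0 \<le> h" and f: "\<And>i. f i = 0 \<or> f i = h"
    have f0: "0 \<le> f i" "f i \<le> h" for i using f[of i] h by auto
    show "(\<integral>\<theta>. f (X \<theta>) \<partial>M) = 0 \<or> \<eta> * h \<le> (\<integral>\<theta>. f (X \<theta>) \<partial>M)"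
    proof (cases "\<exists>i\<in>I. P i \<noteq> 0 \<and> f i = h")
      case True
      then obtain i where i: "i \<in> I" "P i \<noteq> 0" "f i = h" by blast
      have "\<eta> * h \<le> P i * h" using \<eta>[OF i(1,2)] h by (rule mult_right_mono)
      also have "\<dots> = (\<integral>\<theta>. indicator {\<theta> \<in> space M. X \<theta> = i} \<theta> * h \<partial>M)"
        by (simp add: P_def)
      also have "\<dots> \<le> (\<integral>\<theta>. f (X \<theta>) \<partial>M)"
      proof (rule integral_mono)
        show "integrable M (\<lambda>\<theta>. indicator {\<theta> \<in> space M. X \<theta> = i} \<theta> * h)"
          by (intro integrable_mult_left integrable_real_indicator) (auto simp: emeasure_eq_measure)
        show "integrable M (\<lambda>\<theta>. f (X \<theta>))"
          by (rule integrable_const_bound[of _ h]) (use f0 measurable_compose[OF X, of f borel] in auto)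
      qed (use f0 i(3) in \<open>auto simp: indicator_def\<close>)
      finally show ?thesis by blast
    next
      case False
      have "AE \<theta> in M. \<forall>i\<in>{i\<in>I. P i = 0}. X \<theta> \<noteq> i"
      proof (rule AE_finite_allI)
        fix i assume "i \<in> {i\<in>I. P i = 0}"
        then show "AE \<theta> in M. X \<theta> \<noteq> i"
          by (intro AE_I[of _ _ "{\<theta> \<in> space M. X \<theta> = i}"]) (auto simp: P_def emeasure_eq_measure)
      qed (use \<open>finite I\<close> in simp)
      with AE_space have "AE \<theta> in M. f (X \<theta>) = 0"
        by eventually_elim (use False f assms(3) in blast)
      then show ?thesis by (simp add: integral_eq_zero_AE)
    qed
  qed
qed

text \<open>The homothety with center \<open>x\<close> and ratio 1 - a maps the ball of radius
  \<rho> about \<open>q\<close> onto this ball, and it moves every point y along the segment from y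
  to x.\<close>

lemma ball_on_cone_subset:
  fixes q x :: "'a::real_normed_vector"
  assumes "\<And>y. y \<in> ball q \<kappa> \<Longrightarrow> closed_segment x y \<subseteq> \<Omega>" "\<rho> \<le> \<kappa>" "0 \<le> a" "a < 1"
  shows "ball (q + a *\<^sub>R (x - q)) (\<rho> * (1 - a)) \<subseteq> \<Omega>"
proof
  fix z assume z: "z \<in> ball (q + a *\<^sub>R (x - q)) (\<rho> * (1 - a))"
  define y where "y = q + inverse (1 - a) *\<^sub>R (z - (q + a *\<^sub>R (x - q)))"
  have "norm (z - (q + a *\<^sub>R (x - q))) < \<rho> * (1 - a)" using z by (simp add: dist_norm norm_minus_commute)
  moreover have "norm (y - q) = norm (z - (q + a *\<^sub>R (x - q))) / (1 - a)"
    using \<open>a < 1\<close> by (simp add: y_def divide_inverse mult.commute)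
  ultimately have "norm (y - q) < \<rho>" using \<open>a < 1\<close> by (simp add: pos_divide_less_eq)
  then have y: "y \<in> ball q \<kappa>" using assms(2) by (simp add: dist_norm norm_minus_commute)
  have "(1 - a) *\<^sub>R (y - q) = z - (q + a *\<^sub>R (x - q))" using \<open>a < 1\<close> by (simp add: y_def)
  then have "z = a *\<^sub>R x + (1 - a) *\<^sub>R y" by (simp add: algebra_simps)
  then have "z \<in> closed_segment x y"
    unfolding in_segment using assms(3,4) by (intro exI[of _ "1 - a"]) auto
  then show "z \<in> \<Omega>" using assms(1)[OF y] by blast
qed

text \<open>Three-phase clock: \<open>contract\<close> runs from 1 to 0 on \<open>[0, 1/3]\<close>, \<open>travel\<close> from 0 to 1 on \<open>[1/3, 2/3]\<close>, and
  \<open>expand\<close> from 0 to 1 on \<open>[2/3, 1]\<close>. The primed functions are their derivatives off the breakpoints.\<close>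

definition contract :: "real \<Rightarrow> real" where "contract t = max 0 (1 - 3 * t)"
definition contract' :: "real \<Rightarrow> real" where "contract' t = (if t < 1/3 then - 3 else 0)"
definition expand :: "real \<Rightarrow> real" where "expand t = max 0 (3 * t - 2)"
definition expand' :: "real \<Rightarrow> real" where "expand' t = (if 2/3 < t then 3 else 0)"
definition travel :: "real \<Rightarrow> real" where "travel t = max 0 (min 1 (3 * t - 1))"
definition travel' :: "real \<Rightarrow> real" where "travel' t = (if 1/3 < t \<and> t < 2/3 then 3 else 0)"

lemma clock_measurable [measurable]:
  "contract \<in> borel_measurable borel" "contract' \<in> borel_measurable borel"
  "expand \<in> borel_measurable borel" "expand' \<in> borel_measurable borel"
  "travel \<in> borel_measurable borel" "travel' \<in> borel_measurable borel"
  unfolding contract_def[abs_def] contract'_def[abs_def] expand_def[abs_def] expand'_def[abs_def]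
    travel_def[abs_def] travel'_def[abs_def] by measurable

lemma clock_continuous:
  "continuous_on S contract" "continuous_on S expand" "continuous_on S travel"
  unfolding contract_def[abs_def] expand_def[abs_def] travel_def[abs_def]
  by (intro continuous_intros)+

lemma clock_deriv:
  assumes "t \<notin> {1/3, 2/3}"
  shows "(contract has_real_derivative contract' t) (at t)"
    "(expand has_real_derivative expand' t) (at t)"
    "(travel has_real_derivative travel' t) (at t)"
proof -
  consider "t < 1/3" | "1/3 < t" "t < 2/3" | "2/3 < t" using assms by fastforce
  then have "(contract has_real_derivative contract' t) (at t) \<and> (expand has_real_derivative expand' t) (at t) \<and>
    (travel has_real_derivative travel' t) (at t)"
  proof cases
    case 1
    have t: "open {..<1/3::real}" "t \<in> {..<1/3}" using 1 by auto
    have "((\<lambda>t. 1 - 3 * t) has_real_derivative - 3) (at t)" "((\<lambda>t. 0) has_real_derivative 0) (at t)"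
      by (auto intro!: derivative_eq_intros)
    note d = this[THEN has_field_derivative_transform_within_open[OF _ t]]
    have "(contract has_real_derivative contract' t) (at t)"
      using 1 by (auto simp: contract'_def contract_def intro!: d(1))
    moreover have "(expand has_real_derivative expand' t) (at t)"
      using 1 by (auto simp: expand'_def expand_def intro!: d(2))
    moreover have "(travel has_real_derivative travel' t) (at t)"
      using 1 by (auto simp: travel'_def travel_def intro!: d(2))
    ultimately show ?thesis by blast
  next
    case 2
    have t: "open {1/3<..<2/3::real}" "t \<in> {1/3<..<2/3}" using 2 by auto
    have "((\<lambda>t. 3 * t - 1) has_real_derivative 3) (at t)" "((\<lambda>t. 0) has_real_derivative 0) (at t)"
      by (auto intro!: derivative_eq_intros)
    note d = this[THEN has_field_derivative_transform_within_open[OF _ t]]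
    have "(contract has_real_derivative contract' t) (at t)"
      using 2 by (auto simp: contract'_def contract_def intro!: d(2))
    moreover have "(expand has_real_derivative expand' t) (at t)"
      using 2 by (auto simp: expand'_def expand_def intro!: d(2))
    moreover have "(travel has_real_derivative travel' t) (at t)"
      using 2 by (auto simp: travel'_def travel_def intro!: d(1))
    ultimately show ?thesis by blast
  next
    case 3
    have t: "open {2/3::real<..}" "t \<in> {2/3<..}" using 3 by auto
    have "((\<lambda>t. 3 * t - 2) has_real_derivative 3) (at t)" "((\<lambda>t. 0) has_real_derivative 0) (at t)"
      "((\<lambda>t. 1) has_real_derivative 0) (at t)"
      by (auto intro!: derivative_eq_intros)
    note d = this[THEN has_field_derivative_transform_within_open[OF _ t]]
    have "(contract has_real_derivative contract' t) (at t)"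
      using 3 by (auto simp: contract'_def contract_def intro!: d(2))
    moreover have "(expand has_real_derivative expand' t) (at t)"
      using 3 by (auto simp: expand'_def expand_def intro!: d(1))
    moreover have "(travel has_real_derivative travel' t) (at t)"
      using 3 by (auto simp: travel'_def travel_def intro!: d(3))
    ultimately show ?thesis by blast
  qed
  then show "(contract has_real_derivative contract' t) (at t)"
    "(expand has_real_derivative expand' t) (at t)"
    "(travel has_real_derivative travel' t) (at t)" by auto
qed

text \<open>For the finitely many pairs of indices below \<open>n\<close>, a maximum of speeds and a
  minimum of tube radii give common constants, fixed independently of the size of the balls that
  will travel.\<close>

lemma connected_open_smooth_paths:
  fixes \<Omega> :: "'a::euclidean_space set" and q :: "nat \<Rightarrow> 'a"
  assumes "open \<Omega>" "connected \<Omega>" "\<And>i. q i \<in> \<Omega>"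
  obtains g g' D \<kappa> where "\<And>i j. g i j 0 = q i" "\<And>i j. g i j 1 = q j"
    "\<And>i j t. (g i j has_vector_derivative g' i j t) (at t)" "\<And>i j. continuous_on UNIV (g' i j)"
    "0 \<le> D" "0 < \<kappa>"
    "\<And>i j t. i < n \<Longrightarrow> j < n \<Longrightarrow> t \<in> {0..1::real} \<Longrightarrow> norm (g' i j t) \<le> D \<and> ball (g i j t) \<kappa> \<subseteq> \<Omega>"
proof -
  define ok where "ok i j d \<longleftrightarrow> (case d of (g, g', D, \<kappa>) \<Rightarrow> g 0 = q i \<and> g 1 = q j \<and>
    (\<forall>t. (g has_vector_derivative g' t) (at t)) \<and> continuous_on UNIV g' \<and> 0 < \<kappa> \<and>
    (\<forall>t\<in>{0..1::real}. norm (g' t) \<le> D \<and> ball (g t) \<kappa> \<subseteq> \<Omega>))" for i j d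
  have "\<exists>d. ok i j d" for i j
  proof (rule connected_open_smooth_path[OF assms(1,2) assms(3)[of i] assms(3)[of j]])
    fix g g' D \<kappa> assume *: "g 0 = q i" "g 1 = q j" "\<And>t. (g has_vector_derivative g' t) (at t)"
      "continuous_on UNIV g'" "0 < \<kappa>" "\<And>t. t \<in> {0..1::real} \<Longrightarrow> norm (g' t) \<le> D \<and> ball (g t) \<kappa> \<subseteq> \<Omega>"
    have "ok i j (g, g', D, \<kappa>)" unfolding ok_def using * by simp
    then show ?thesis ..
  qed
  then obtain d where d: "\<And>i j. ok i j (d i j)" by metis
  define g g' D \<kappa> where "g i j = fst (d i j)" and "g' i j = fst (snd (d i j))"
    and "D i j = fst (snd (snd (d i j)))" and "\<kappa> i j = snd (snd (snd (d i j)))" for i j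
  note ok = d[unfolded ok_def case_prod_unfold, folded g_def g'_def D_def \<kappa>_def]
  let ?I = "{..<n} \<times> {..<n}"
  define D' where "D' = Max (insert 0 ((\<lambda>(i, j). D i j) ` ?I))"
  define \<kappa>' where "\<kappa>' = Min (insert 1 ((\<lambda>(i, j). \<kappa> i j) ` ?I))"
  show ?thesis
  proof (rule that[of g g' D' \<kappa>'])
    show "0 \<le> D'" unfolding D'_def by (rule Max_ge) auto
    show "0 < \<kappa>'" unfolding \<kappa>'_def using ok by (subst Min_gr_iff) auto
    fix i j t assume *: "i < n" "j < n" "t \<in> {0..1::real}"
    have "D i j \<le> D'" unfolding D'_def using * by (intro Max_ge) auto
    moreover have "\<kappa>' \<le> \<kappa> i j" unfolding \<kappa>'_def using * by (intro Min_le) auto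
    then have "ball (g i j t) \<kappa>' \<subseteq> ball (g i j t) (\<kappa> i j)" by auto
    ultimately show "norm (g' i j t) \<le> D' \<and> ball (g i j t) \<kappa>' \<subseteq> \<Omega>" using ok[of i j] *(3) by force
  qed (use ok in auto)
qed

text \<open>The height of a ball is proportional to r^(-d). Restricting to r \<le> 1 gives r^d \<le>
  r, so a condition linear in r suffices in every dimension.\<close>

lemma exists_concentrated_ball:
  assumes "0 < \<kappa>" "0 < \<eta>" "0 < M"
  obtains r where "0 < r" "r \<le> \<kappa>" "M \<le> \<eta> * (1 / (unit_ball_vol (real DIM('a::euclidean_space)) * r ^ DIM('a)))"
proof -
  let ?v = "unit_ball_vol (real DIM('a))"
  have v: "0 < ?v" by simp
  define r where "r = min \<kappa> (min 1 (\<eta> / (?v * M)))"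
  have r: "0 < r" "r \<le> \<kappa>" "r \<le> 1" "r \<le> \<eta> / (?v * M)" using assms v by (auto simp: r_def)
  have "r ^ DIM('a) \<le> r ^ 1" using r by (intro power_decreasing) (auto simp: Suc_leI)
  then have "?v * r ^ DIM('a) * M \<le> ?v * r * M" using v assms by (intro mult_right_mono mult_left_mono) auto
  also have "\<dots> \<le> \<eta>" using r(4) v assms by (simp add: pos_le_divide_eq mult_ac)
  finally have "M \<le> \<eta> * (1 / (?v * r ^ DIM('a)))"
    using v r(1) by (simp add: pos_le_divide_eq mult_ac)
  with r show ?thesis using that by blast
qed

text \<open>The tests here are only \<open>C\<^sup>1\<close>, need not be compactly supported, and the integrals run over the whole
  space-time, where \<open>F\<close> (and in the application \<open>J\<close>) vanishes outside \<open>[0,1] \<times> \<Omega>\<close>.\<close>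

definition transports ::
  "'a::euclidean_space set \<Rightarrow> 'a measure \<Rightarrow> 'a measure \<Rightarrow> (real \<times> 'a \<Rightarrow> real) \<Rightarrow> (real \<times> 'a \<Rightarrow> 'a) \<Rightarrow> bool" where
  "transports \<Omega> P0 P1 F J \<longleftrightarrow> integrable lborel F \<and> integrable lborel J \<and>
    (\<forall>p. 0 \<le> F p) \<and> (\<forall>p. p \<notin> {0..1} \<times> \<Omega> \<longrightarrow> F p = 0) \<and> integral\<^sup>L lborel F = 1 \<and>
    (\<forall>\<phi> :: real \<times> 'a \<Rightarrow> real. (\<forall>z. \<phi> differentiable (at z)) \<longrightarrow>
      (\<forall>v. continuous_on UNIV (\<lambda>z. frechet_derivative \<phi> (at z) v)) \<longrightarrow>
      integrable lborel (\<lambda>p. F p * frechet_derivative \<phi> (at p) (1, 0) + frechet_derivative \<phi> (at p) (0, J p)) \<and>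
      (\<integral>p. F p * frechet_derivative \<phi> (at p) (1, 0) + frechet_derivative \<phi> (at p) (0, J p) \<partial>lborel) =
      (\<integral>x. \<phi> (1, x) \<partial>P1) - (\<integral>x. \<phi> (0, x) \<partial>P0))"

text \<open>The order of the choices is what matters: the fast speed \<open>D\<close> is fixed
  before the density threshold \<open>M\<close>, so \<open>M\<close> may be adapted to
  \<open>D\<close>. Slow motion may occur at any density, fast motion only at points of density at
  least \<open>M\<close>; where \<open>F\<close> vanishes, so does \<open>J\<close>.\<close>

lemma concentrating_transport:
  fixes \<Omega> :: "'a::euclidean_space set" and P0 P1 :: "'a measure"
  assumes \<Omega>: "open \<Omega>" "bounded \<Omega>" "connected \<Omega>" "lipschitz_boundary \<Omega>" and "\<Omega> \<noteq> {}"
    and P0: "prob_space P0" "sets P0 = sets borel" "AE x in P0. x \<in> \<Omega>"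
    and P1: "prob_space P1" "sets P1 = sets borel" "AE x in P1. x \<in> \<Omega>"
    and "0 < \<epsilon>"
  obtains D :: real where "0 \<le> D" "\<And>M. 0 < M \<Longrightarrow> \<exists>F J. transports \<Omega> P0 P1 F J \<and>
    (\<forall>p. norm (J p) \<le> \<epsilon> * F p \<or> norm (J p) \<le> D * F p \<and> (F p = 0 \<or> M \<le> F p))"
proof -
  \<comment> \<open>Each phase lasts a third of the unit time interval, so lengths become speeds
    with a factor 3; this is also why the travel speed below is \<open>3 * D\<close>.\<close>
  have "0 < \<epsilon> / 3" using \<open>0 < \<epsilon>\<close> by simp
  from lipschitz_domain_cells[OF \<Omega>(1,2,4) this]
  obtain n :: nat and q0 c \<kappa>0 where \<kappa>0: "0 < \<kappa>0" and c [measurable]: "c \<in> borel \<rightarrow>\<^sub>M count_space UNIV"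
    and cn: "\<And>x. x \<in> \<Omega> \<Longrightarrow> c x < n" and q0: "\<And>i. i < n \<Longrightarrow> q0 i \<in> \<Omega>"
    and cell: "\<And>x y. x \<in> \<Omega> \<Longrightarrow> y \<in> ball (q0 (c x)) \<kappa>0 \<Longrightarrow> dist x y \<le> \<epsilon> / 3 \<and> closed_segment x y \<subseteq> \<Omega>"
    by metis
  obtain x0 where x0: "x0 \<in> \<Omega>" using \<open>\<Omega> \<noteq> {}\<close> by blast
  \<comment> \<open>Indices from \<open>n\<close> on get an arbitrary point of \<Omega>, so that
    paths can be chosen for all pairs of indices.\<close>
  define q where "q i = (if i < n then q0 i else x0)" for i
  have q: "q i \<in> \<Omega>" for i using q0 x0 by (simp add: q_def)
  obtain g g' D \<kappa>1 where g: "\<And>i j. g i j 0 = q i" "\<And>i j. g i j 1 = q j"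
    "\<And>i j t. (g i j has_vector_derivative g' i j t) (at t)" "\<And>i j. continuous_on UNIV (g' i j)"
    and D: "0 \<le> D" and \<kappa>1: "0 < \<kappa>1"
    and gD: "\<And>i j t. i < n \<Longrightarrow> j < n \<Longrightarrow> t \<in> {0..1::real} \<Longrightarrow> norm (g' i j t) \<le> D \<and> ball (g i j t) \<kappa>1 \<subseteq> \<Omega>"
    by (rule connected_open_smooth_paths[of \<Omega> q n, OF \<Omega>(1,3) q]) rule
  \<comment> \<open>\<open>r\<close> moves the null set outside \<open>\<Omega>\<close> into \<open>\<Omega>\<close>, so that all curves stay in \<open>\<Omega>\<close>\<close>
  define r where "r x = (if x \<in> \<Omega> then x else x0)" for x
  have r\<Omega>: "r x \<in> \<Omega>" for x using x0 by (simp add: r_def)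
  have [measurable]: "\<Omega> \<in> sets borel" using \<Omega>(1) by simp
  have r_meas [measurable]: "r \<in> borel_measurable borel" unfolding r_def[abs_def] by measurable
  have g_meas [measurable]: "g i j \<in> borel_measurable borel" "g' i j \<in> borel_measurable borel" for i j
  proof -
    have "continuous_on UNIV (g i j)"
      using g(3) by (auto intro!: continuous_at_imp_continuous_on has_vector_derivative_continuous)
    then show "g i j \<in> borel_measurable borel" "g' i j \<in> borel_measurable borel"
      using g(4) by (auto intro: borel_measurable_continuous_onI)
  qed
  \<comment> \<open>independent coupling: any start is connected to any end\<close>
  define \<Theta> where "\<Theta> = P0 \<Otimes>\<^sub>M P1"
  interpret P: pair_prob_space P0 P1
    using P0(1) P1(1) by (simp add: pair_prob_space_def pair_sigma_finite_def prob_space_imp_sigma_finite)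
  have [measurable_cong]: "sets \<Theta> = sets (borel \<Otimes>\<^sub>M borel)"
    unfolding \<Theta>_def using P0(2) P1(2) by (rule sets_pair_measure_cong)
  interpret \<Theta>: prob_space \<Theta> unfolding \<Theta>_def by (rule P.P.prob_space_axioms)
  define X where "X \<theta> = (c (r (fst \<theta>)), c (r (snd \<theta>)))" for \<theta>
  have X [measurable]: "X \<in> \<Theta> \<rightarrow>\<^sub>M count_space UNIV"
  proof -
    have [measurable]: "(\<lambda>\<theta>. c (r (snd \<theta>))) \<in> \<Theta> \<rightarrow>\<^sub>M count_space UNIV"
      "(\<lambda>\<theta>. c (r (fst \<theta>))) \<in> \<Theta> \<rightarrow>\<^sub>M count_space UNIV" by measurable
    have "(\<lambda>\<theta>. (i, c (r (snd \<theta>)))) \<in> \<Theta> \<rightarrow>\<^sub>M count_space UNIV" for i :: nat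
      by (rule measurable_compose[where N = "count_space UNIV"]) auto
    then show ?thesis
      unfolding X_def[abs_def] by (rule measurable_compose_countable) measurable
  qed
  have XI: "X \<theta> \<in> {..<n} \<times> {..<n}" for \<theta> using cn[OF r\<Omega>] by (simp add: X_def)
  have "finite ({..<n} \<times> {..<n})" by simp
  from \<Theta>.finitely_valued_dichotomy[OF X this XI]
  obtain \<eta> where \<eta>: "0 < \<eta>" "\<And>(f :: nat \<times> nat \<Rightarrow> real) h. 0 \<le> h \<Longrightarrow> (\<And>i. f i = 0 \<or> f i = h) \<Longrightarrow>
    (\<integral>\<theta>. f (X \<theta>) \<partial>\<Theta>) = 0 \<or> \<eta> * h \<le> (\<integral>\<theta>. f (X \<theta>) \<partial>\<Theta>)"
    by blast
  show ?thesis
  proof (rule that[of "3 * D"])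
    show "0 \<le> 3 * D" using D by simp
    fix M :: real assume "0 < M"
    have "0 < min \<kappa>0 \<kappa>1" using \<kappa>0 \<kappa>1 by simp
    from exists_concentrated_ball[OF this \<eta>(1) \<open>0 < M\<close>, where 'a = 'a] obtain l where l: "0 < l" "l \<le> min \<kappa>0 \<kappa>1"
      and lM: "M \<le> \<eta> * (1 / (unit_ball_vol (real DIM('a)) * l ^ DIM('a)))" by blast
    \<comment> \<open>In each phase two of the three clocks stand still. At times 0 and 1 the path
      sits at \<open>q i\<close> or \<open>q j\<close> and the offset has full size, so the center
      is exactly \<open>r (fst \<theta>)\<close> or \<open>r (snd \<theta>)\<close>.\<close>
    define A where "A t \<theta> = (case X \<theta> of (i, j) \<Rightarrow>
      g i j (travel t) + contract t *\<^sub>R (r (fst \<theta>) - q i) + expand t *\<^sub>R (r (snd \<theta>) - q j))" for t \<theta>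
    define A' where "A' t \<theta> = (case X \<theta> of (i, j) \<Rightarrow> travel' t *\<^sub>R g' i j (travel t) +
      contract' t *\<^sub>R (r (fst \<theta>) - q i) + expand' t *\<^sub>R (r (snd \<theta>) - q j))" for t \<theta>
    \<comment> \<open>When the offset of the center from the cell point is scaled by a, the radius
      is l (1 - a): exactly the homothetic balls of \<open>ball_on_cone_subset\<close>.\<close>
    define s where "s t = l * (1 - contract t - expand t)" for t
    define s' where "s' t = - l * (contract' t + expand' t)" for t
    define B where "B t = (if 1/3 \<le> t \<and> t \<le> 2/3 then 3 * D else \<epsilon>)" for t :: real
    have q': "q0 i = q i" if "i < n" for i using that by (simp add: q_def)
    have cell': "dist (r x) y \<le> \<epsilon> / 3 \<and> closed_segment (r x) y \<subseteq> \<Omega>" if "y \<in> ball (q (c (r x))) \<kappa>0" for x y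
      using cell[OF r\<Omega>[of x], of y] that q'[OF cn[OF r\<Omega>]] by simp
    interpret moving_balls \<Theta> A A' s s' B "{1/3, 2/3}" "max (3 * D) \<epsilon>" \<Omega>
    proof
      show "case_prod A \<in> borel_measurable (borel \<Otimes>\<^sub>M \<Theta>)"
        unfolding A_def[abs_def] case_prod_unfold
        by (rule measurable_compose_countable[where g = "\<lambda>p. X (snd p)"]) measurable
      show "case_prod A' \<in> borel_measurable (borel \<Otimes>\<^sub>M \<Theta>)"
        unfolding A'_def[abs_def] case_prod_unfold
        by (rule measurable_compose_countable[where g = "\<lambda>p. X (snd p)"]) measurable
      show "s \<in> borel_measurable borel" "s' \<in> borel_measurable borel"
        unfolding s_def[abs_def] s'_def[abs_def] by measurable
      have gc: "continuous_on {0..1} (\<lambda>t. g i j (travel t))" for i j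
        by (rule continuous_on_compose2[of UNIV "g i j"])
          (use g(3) in \<open>auto intro!: clock_continuous continuous_at_imp_continuous_on has_vector_derivative_continuous\<close>)
      show "continuous_on {0..1} (\<lambda>t. A t \<theta>)" for \<theta>
        unfolding A_def case_prod_unfold by (intro continuous_intros gc clock_continuous)
      show "continuous_on {0..1} s" unfolding s_def[abs_def] by (intro continuous_intros clock_continuous)
      show "s 0 = 0" "s 1 = 0" by (auto simp: s_def contract_def expand_def)
      show "0 < s t" if "t \<in> {0<..<1}" for t
        unfolding s_def using that l(1) by (intro mult_pos_pos) (auto simp: contract_def expand_def max_def)
      show "(s has_vector_derivative s' t) (at t)" if "t \<in> {0<..<1} - {1/3, 2/3}" for t
        unfolding s_def[abs_def] s'_def has_real_derivative_iff_has_vector_derivative[symmetric]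
        using that by (auto intro!: derivative_eq_intros clock_deriv simp: algebra_simps)
      show "((\<lambda>t. A t \<theta>) has_vector_derivative A' t \<theta>) (at t)" if "t \<in> {0<..<1} - {1/3, 2/3}" for t \<theta>
      proof -
        have t: "t \<notin> {1/3, 2/3}" using that by simp
        have gt: "((\<lambda>t. g i j (travel t)) has_vector_derivative travel' t *\<^sub>R g' i j (travel t)) (at t)" for i j
          using vector_diff_chain_at[OF clock_deriv(3)[OF t, unfolded has_real_derivative_iff_has_vector_derivative] g(3)]
          by (simp add: o_def)
        have "((\<lambda>t. contract t *\<^sub>R v) has_vector_derivative contract' t *\<^sub>R v) (at t)"
          "((\<lambda>t. expand t *\<^sub>R v) has_vector_derivative expand' t *\<^sub>R v) (at t)" for v :: 'a
          using clock_deriv(1,2)[OF t] by (auto intro!: derivative_eq_intros)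
        then show ?thesis unfolding A_def A'_def case_prod_unfold
          by (intro has_vector_derivative_add gt)
      qed
      show "B t \<le> max (3 * D) \<epsilon>" for t by (auto simp: B_def)
      show "bounded \<Omega>" by fact
    next
      fix t :: real and \<theta> :: "'a \<times> 'a" assume t: "t \<in> {0<..<1}"
      obtain x y where \<theta>: "\<theta> = (x, y)" by force
      note ij = cn[OF r\<Omega>[of x]] cn[OF r\<Omega>[of y]]
      have l0: "l \<le> \<kappa>0" and l1: "l \<le> \<kappa>1" using l by auto
      show "ball (A t \<theta>) (s t) \<subseteq> \<Omega>"
      proof -
        consider "t < 1/3" | "1/3 \<le> t" "t \<le> 2/3" | "2/3 < t" by linarith
        then show ?thesis
        proof cases
          case 1
          then have "ball (q (c (r x)) + contract t *\<^sub>R (r x - q (c (r x)))) (l * (1 - contract t)) \<subseteq> \<Omega>"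
            using t l0 cell'[of _ x] by (intro ball_on_cone_subset[of _ \<kappa>0]) (auto simp: contract_def)
          moreover have "travel t = 0" "expand t = 0" using 1 by (auto simp: travel_def expand_def)
          ultimately show ?thesis by (simp add: A_def s_def \<theta> X_def g)
        next
          case 2
          then have "contract t = 0" "expand t = 0" "travel t \<in> {0..1}"
            by (auto simp: travel_def expand_def contract_def)
          then show ?thesis using gD[OF ij, of "travel t"] l1 by (auto simp: A_def s_def \<theta> X_def)
        next
          case 3
          then have "ball (q (c (r y)) + expand t *\<^sub>R (r y - q (c (r y)))) (l * (1 - expand t)) \<subseteq> \<Omega>"
            using t l0 cell'[of _ y] by (intro ball_on_cone_subset[of _ \<kappa>0]) (auto simp: expand_def)
          moreover have "travel t = 1" "contract t = 0" using 3 by (auto simp: travel_def contract_def)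
          ultimately show ?thesis by (simp add: A_def s_def \<theta> X_def g)
        qed
      qed
      fix w :: 'a assume w: "w \<in> ball 0 1"
      \<comment> \<open>During contraction and expansion the particle with relative position
        \<open>w\<close> moves on a straight line between \<open>r x\<close> and its place in the
        ball of radius \<open>l\<close>; this bounds the length of that line.\<close>
      have small: "norm (r x - (q (c (r x)) + l *\<^sub>R w)) \<le> \<epsilon> / 3" for x
      proof -
        have "l * norm w < l * 1" using w l(1) by (intro mult_strict_left_mono) auto
        then have "l * norm w < \<kappa>0" using l0 by linarith
        then have "q (c (r x)) + l *\<^sub>R w \<in> ball (q (c (r x))) \<kappa>0" using l(1) by (simp add: dist_norm)
        from cell'[OF this] show ?thesis by (simp add: dist_norm)
      qed
      show "norm (A' t \<theta> + s' t *\<^sub>R w) \<le> B t"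
      proof -
        consider "t < 1/3" | "1/3 \<le> t" "t \<le> 2/3" | "2/3 < t" by linarith
        then show ?thesis
        proof cases
          case 1
          then have "A' t \<theta> + s' t *\<^sub>R w = - 3 *\<^sub>R (r x - (q (c (r x)) + l *\<^sub>R w))"
            by (simp add: A'_def s'_def \<theta> X_def contract'_def expand'_def travel'_def algebra_simps)
          then show ?thesis using small[of x] 1 by (simp only: norm_scaleR) (simp add: B_def)
        next
          case 2
          then have "norm (g' (c (r x)) (c (r y)) (travel t)) \<le> D"
            using gD[OF ij, of "travel t"] by (auto simp: travel_def)
          moreover have "A' t \<theta> + s' t *\<^sub>R w = travel' t *\<^sub>R g' (c (r x)) (c (r y)) (travel t)"
            using 2 by (simp add: A'_def s'_def \<theta> X_def contract'_def expand'_def)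
          ultimately show ?thesis using 2 D by (simp add: B_def travel'_def)
        next
          case 3
          then have "A' t \<theta> + s' t *\<^sub>R w = 3 *\<^sub>R (r y - (q (c (r y)) + l *\<^sub>R w))"
            by (simp add: A'_def s'_def \<theta> X_def contract'_def expand'_def travel'_def algebra_simps)
          then show ?thesis using small[of y] 3 by (simp only: norm_scaleR) (simp add: B_def)
        qed
      qed
    qed simp
    have dich: "norm (J p) \<le> \<epsilon> * F p \<or> norm (J p) \<le> 3 * D * F p \<and> (F p = 0 \<or> M \<le> F p)" for p
    proof (cases "1/3 \<le> fst p \<and> fst p \<le> 2/3")
      case True
      let ?h = "1 / (unit_ball_vol (real DIM('a)) * l ^ DIM('a))"
      let ?f = "\<lambda>ij. if dist (case ij of (i, j) \<Rightarrow> g i j (travel (fst p))) (snd p) < l then ?h else 0"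
      have "contract (fst p) = 0" "expand (fst p) = 0" using True by (auto simp: contract_def expand_def)
      \<comment> \<open>In the middle phase all radii equal \<open>l\<close> and the center depends
        on \<theta> only through the pair of cells \<open>X \<theta>\<close>, so the density is the
        average of a function with values 0 and \<open>?h\<close>.\<close>
      then have "k p \<theta> = ?f (X \<theta>)" for \<theta>
        using True by (simp add: k_def ball_density_def A_def s_def case_prod_unfold)
      then have F: "F p = (\<integral>\<theta>. ?f (X \<theta>) \<partial>\<Theta>)" by (simp add: F_def)
      have "F p = 0 \<or> \<eta> * ?h \<le> F p" unfolding F using l(1) by (intro \<eta>(2)) auto
      then show ?thesis using norm_J[of p] True lM by (auto simp: B_def)
    next
      case False
      then show ?thesis using norm_J[of p] by (auto simp: B_def)
    qed
    have ends: "(\<integral>\<theta>. \<phi> (1, A 1 \<theta>) - \<phi> (0, A 0 \<theta>) \<partial>\<Theta>) = (\<integral>x. \<phi> (1, x) \<partial>P1) - (\<integral>x. \<phi> (0, x) \<partial>P0)"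
      if "\<forall>z. \<phi> differentiable (at z)" for \<phi> :: "real \<times> 'a \<Rightarrow> real"
    proof -
      have cont: "continuous_on UNIV \<phi>"
        using that by (simp add: differentiable_imp_continuous_on differentiable_on_def differentiable_at_withinI)
      have [measurable]: "(\<lambda>x. \<phi> (t, x)) \<in> borel_measurable borel" for t
        by (intro borel_measurable_continuous_onI continuous_on_compose2[OF cont] continuous_intros) auto
      have comp: "compact ((\<lambda>x. \<phi> (t, x)) ` closure \<Omega>)" for t
        using \<Omega>(2) by (intro compact_continuous_image continuous_on_compose2[OF cont] continuous_intros) auto
      have "\<exists>C. \<forall>x\<in>closure \<Omega>. \<bar>\<phi> (t, x)\<bar> \<le> C" for t
        using compact_imp_bounded[OF comp[of t]] by (simp add: bounded_iff)
      then obtain C where C: "\<And>t x. x \<in> closure \<Omega> \<Longrightarrow> \<bar>\<phi> (t, x)\<bar> \<le> C t" by metis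
      \<comment> \<open>A test may be unbounded on the whole space; \<open>r\<close> keeps its
        argument in \<Omega>, whose closure is compact.\<close>
      have Cr: "\<bar>\<phi> (t, r x)\<bar> \<le> C t" for t x using C r\<Omega>[of x] closure_subset by blast
      have i1: "integrable \<Theta> (\<lambda>\<theta>. \<phi> (1, r (snd \<theta>)))" and i0: "integrable \<Theta> (\<lambda>\<theta>. \<phi> (0, r (fst \<theta>)))"
        by (auto intro!: \<Theta>.integrable_const_bound[OF AE_I2] Cr)
      have "A 1 \<theta> = r (snd \<theta>)" "A 0 \<theta> = r (fst \<theta>)" for \<theta>
        by (auto simp: A_def X_def travel_def contract_def expand_def g)
      then have "(\<integral>\<theta>. \<phi> (1, A 1 \<theta>) - \<phi> (0, A 0 \<theta>) \<partial>\<Theta>) =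
          (\<integral>\<theta>. \<phi> (1, r (snd \<theta>)) \<partial>\<Theta>) - (\<integral>\<theta>. \<phi> (0, r (fst \<theta>)) \<partial>\<Theta>)"
        using i1 i0 by simp
      also have "(\<integral>\<theta>. \<phi> (1, r (snd \<theta>)) \<partial>\<Theta>) = (\<integral>y. \<phi> (1, r y) \<partial>P1)"
        using P.integral_fst'[OF i1[unfolded \<Theta>_def]] prob_space.prob_space[OF P0(1)] by (simp add: \<Theta>_def)
      also have "\<dots> = (\<integral>y. \<phi> (1, y) \<partial>P1)"
        using P1(3) by (intro integral_cong_AE) (auto simp: r_def P1(2) cong: measurable_cong_sets)
      also have "(\<integral>\<theta>. \<phi> (0, r (fst \<theta>)) \<partial>\<Theta>) = (\<integral>y. \<phi> (0, r y) \<partial>P0)"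
        using P.integral_fst'[OF i0[unfolded \<Theta>_def]] prob_space.prob_space[OF P1(1)] by (simp add: \<Theta>_def)
      also have "\<dots> = (\<integral>y. \<phi> (0, y) \<partial>P0)"
        using P0(3) by (intro integral_cong_AE) (auto simp: r_def P0(2) cong: measurable_cong_sets)
      finally show ?thesis .
    qed
    have weak: "(\<integral>p. F p * frechet_derivative \<phi> (at p) (1, 0) + frechet_derivative \<phi> (at p) (0, J p) \<partial>lborel) =
        (\<integral>x. \<phi> (1, x) \<partial>P1) - (\<integral>x. \<phi> (0, x) \<partial>P0)"
      if "\<forall>z. \<phi> differentiable (at z)" "\<forall>v. continuous_on UNIV (\<lambda>z. frechet_derivative \<phi> (at z) v)"
      for \<phi> :: "real \<times> 'a \<Rightarrow> real"
      using weak_form[of \<phi>] ends[OF that(1)] that by metis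
    have "transports \<Omega> P0 P1 F J"
      unfolding transports_def
      by (intro conjI allI impI integrable_F integrable_J F_nonneg F_outside integral_F integrable_weak_form weak) blast+
    with dich show "\<exists>F J. transports \<Omega> P0 P1 F J \<and>
      (\<forall>p. norm (J p) \<le> \<epsilon> * F p \<or> norm (J p) \<le> 3 * D * F p \<and> (F p = 0 \<or> M \<le> F p))"
      by blast
  qed
qed

section \<open>Estimating the action\<close>

lemma test_function_C1:
  assumes "test_function \<phi>"
  shows "\<phi> differentiable (at z)" "continuous_on UNIV (\<lambda>z. frechet_derivative \<phi> (at z) v)"
proof -
  have "C_k (Suc 0) \<phi>" using assms unfolding test_function_def by blast
  then show "\<phi> differentiable (at z)" "continuous_on UNIV (\<lambda>z. frechet_derivative \<phi> (at z) v)" by auto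
qed

lemma integral_lebesgue_on_borel:
  fixes f :: "'a::euclidean_space \<Rightarrow> 'b::euclidean_space"
  assumes [measurable]: "S \<in> sets borel" "f \<in> borel_measurable borel"
  shows "(LINT x|lebesgue_on S. f x) = (\<integral>x. indicator S x *\<^sub>R f x \<partial>lborel)"
    and "integrable (lebesgue_on S) f \<longleftrightarrow> integrable lborel (\<lambda>x. indicator S x *\<^sub>R f x)"
proof -
  have S: "S \<inter> space lebesgue \<in> sets lebesgue" using assms(1) by (simp add: sets_completionI_sets)
  show "(LINT x|lebesgue_on S. f x) = (\<integral>x. indicator S x *\<^sub>R f x \<partial>lborel)"
    unfolding integral_restrict_space[OF S] by (rule integral_completion) measurable
  show "integrable (lebesgue_on S) f \<longleftrightarrow> integrable lborel (\<lambda>x. indicator S x *\<^sub>R f x)"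
    unfolding integrable_restrict_space[OF S] by (rule integrable_completion) measurable
qed

lemma ess_inf_pos:
  assumes "ess_inf M f > 0"
  obtains \<delta> :: real where "0 < \<delta>" "AE x in M. \<delta> \<le> f x"
proof -
  from assms obtain c where c: "0 < c" "AE x in M. c \<le> ereal (f x)"
    unfolding ess_inf_def less_Sup_iff by auto
  have "\<exists>\<delta>>0. ereal \<delta> \<le> c" using c(1)
    by (cases c) (auto intro: exI[of _ "1::real"])
  then obtain \<delta> where \<delta>: "0 < \<delta>" "ereal \<delta> \<le> c" by blast
  from c(2) have "AE x in M. \<delta> \<le> f x" by eventually_elim (use \<delta> order_trans in force)
  with \<delta> show ?thesis using that by blast
qed

text \<open>The given density is only Lebesgue measurable and bounded below only almost everywhere,
  whereas the transported measures are built from a Borel density that is nonnegative everywhere and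
  vanishes off \<Omega>; \<open>v\<close> is such a representative of u - \<delta>.\<close>

lemma excess_density:
  fixes u :: "'a::euclidean_space \<Rightarrow> real"
  assumes [measurable]: "\<Omega> \<in> sets borel" and u: "integrable (lebesgue_on \<Omega>) u"
    and "AE x in lebesgue_on \<Omega>. \<delta> \<le> u x" and "emeasure lborel \<Omega> < \<infinity>"
  obtains v where "v \<in> borel_measurable borel" "\<And>x. 0 \<le> v x" "\<And>x. x \<notin> \<Omega> \<Longrightarrow> v x = 0"
    "integrable lborel v" "AE x in lebesgue_on \<Omega>. u x = \<delta> + v x"
    "(LINT x|lebesgue_on \<Omega>. u x) = \<delta> * measure lborel \<Omega> + integral\<^sup>L lborel v"
proof -
  have S: "\<Omega> \<inter> space lebesgue \<in> sets lebesgue" by (simp add: sets_completionI_sets)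
  have "u \<in> borel_measurable (lebesgue_on \<Omega>)" using u by simp
  then have "(\<lambda>x. if x \<in> \<Omega> then u x else 0) \<in> borel_measurable lebesgue"
    by (simp add: borel_measurable_if sets_completionI_sets)
  from completion_ex_borel_measurable_real[OF this]
  obtain g where [measurable]: "g \<in> borel_measurable borel" and g: "AE x in lborel. (if x \<in> \<Omega> then u x else 0) = g x"
    by auto
  define v where "v x = indicator \<Omega> x * max 0 (g x - \<delta>)" for x
  have v0: "\<And>x. 0 \<le> v x" "\<And>x. x \<notin> \<Omega> \<Longrightarrow> v x = 0" by (simp_all add: v_def)
  have v_meas [measurable]: "v \<in> borel_measurable borel" unfolding v_def[abs_def] by measurable
  have "AE x in lebesgue. (if x \<in> \<Omega> then u x else 0) = g x" using AE_completion[OF g] .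
  moreover have "AE x in lebesgue. x \<in> \<Omega> \<longrightarrow> \<delta> \<le> u x" using assms(3) by (simp add: AE_restrict_space_iff[OF S])
  ultimately have "AE x in lebesgue. x \<in> \<Omega> \<longrightarrow> u x = \<delta> + v x"
    by eventually_elim (auto simp: v_def)
  then have uv: "AE x in lebesgue_on \<Omega>. u x = \<delta> + v x" by (simp add: AE_restrict_space_iff[OF S])
  have "integrable (lebesgue_on \<Omega>) (\<lambda>x. \<delta> + v x)"
    by (rule integrable_cong_AE_imp[OF u]) (use uv in \<open>auto simp: measurable_restrict_space1 measurable_completion\<close>)
  then have i: "integrable lborel (\<lambda>x. indicator \<Omega> x *\<^sub>R (\<delta> + v x))"
    by (subst (asm) integral_lebesgue_on_borel(2)) auto
  have i1: "integrable lborel (\<lambda>x. indicator \<Omega> x * \<delta>)"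
    using assms(4) by (intro integrable_mult_left integrable_real_indicator) auto
  have "integrable lborel (\<lambda>x. indicator \<Omega> x *\<^sub>R (\<delta> + v x) - indicator \<Omega> x * \<delta>)"
    using i i1 by (rule Bochner_Integration.integrable_diff)
  also have "(\<lambda>x. indicator \<Omega> x *\<^sub>R (\<delta> + v x) - indicator \<Omega> x * \<delta>) = v"
    by (auto simp: v_def fun_eq_iff indicator_def)
  finally have iv: "integrable lborel v" .
  have "(LINT x|lebesgue_on \<Omega>. u x) = (LINT x|lebesgue_on \<Omega>. \<delta> + v x)"
    using uv u by (intro integral_cong_AE) (auto simp: measurable_restrict_space1 measurable_completion)
  also have "\<dots> = (\<integral>x. indicator \<Omega> x * \<delta> + v x \<partial>lborel)"
    by (subst integral_lebesgue_on_borel(1)) (auto intro!: Bochner_Integration.integral_cong simp: v_def indicator_def)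
  also have "\<dots> = measure lborel \<Omega> * \<delta> + integral\<^sup>L lborel v"
    using i1 iv by simp
  finally have "(LINT x|lebesgue_on \<Omega>. u x) = \<delta> * measure lborel \<Omega> + integral\<^sup>L lborel v" by simp
  then show ?thesis
    using that[OF v_meas v0(1) v0(2) iv uv] by blast
qed

text \<open>Superlinearity gives an arbitrarily large factor \<open>K\<close> only far out. Near 0
  the ratio m(u)/u may degenerate, hence the restriction u \<ge> \<delta>: on the compact range up
  to \<open>N\<close> the ratio is continuous and attains a positive minimum, and beyond
  \<open>N\<close> it is at least 1.\<close>

lemma superlinear_lower_bounds:
  fixes m :: "real \<Rightarrow> real"
  assumes "continuous_on {0..} m" "m \<in> {0..} \<rightarrow> {0..}" "{u \<in> {0..}. m u = 0} = {0}"
    and lim: "filterlim (\<lambda>u. m u / u) at_top at_top"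
  shows "\<exists>N>0. \<forall>u\<ge>N. K * u \<le> m u" and "0 < \<delta> \<Longrightarrow> \<exists>c>0. \<forall>u\<ge>\<delta>. c * u \<le> m u"
proof -
  have far: "\<exists>N>0. \<forall>u\<ge>N. K * u \<le> m u" for K
  proof -
    have "eventually (\<lambda>u. K \<le> m u / u) at_top" using lim by (simp add: filterlim_at_top)
    then obtain N where N: "\<And>u. N \<le> u \<Longrightarrow> K \<le> m u / u" by (auto simp: eventually_at_top_linorder)
    have "K * u \<le> m u" if "max N 1 \<le> u" for u
      using N[of u] that by (simp add: pos_le_divide_eq)
    then show ?thesis by (intro exI[of _ "max N 1"]) auto
  qed
  then show "\<exists>N>0. \<forall>u\<ge>N. K * u \<le> m u" .
  assume "0 < \<delta>"
  obtain N where N: "0 < N" "\<And>u. N \<le> u \<Longrightarrow> 1 * u \<le> m u" using far[of 1] by blast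
  let ?I = "{\<delta>..max \<delta> N}"
  have "continuous_on ?I (\<lambda>u. m u / u)"
    using \<open>0 < \<delta>\<close> by (intro continuous_intros continuous_on_subset[OF assms(1)]) auto
  moreover have "compact ?I" "?I \<noteq> {}" by auto
  ultimately obtain u0 where u0: "u0 \<in> ?I" "\<And>u. u \<in> ?I \<Longrightarrow> m u0 / u0 \<le> m u / u"
    using continuous_attains_inf[of ?I "\<lambda>u. m u / u"] by blast
  have "0 < u0" using u0(1) \<open>0 < \<delta>\<close> by auto
  moreover have "0 \<le> m u0" using assms(2) \<open>0 < u0\<close> by (auto simp: Pi_iff)
  moreover have "m u0 \<noteq> 0"
  proof
    assume "m u0 = 0"
    then have "u0 \<in> {u \<in> {0..}. m u = 0}" using \<open>0 < u0\<close> by simp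
    then show False unfolding assms(3) using \<open>0 < u0\<close> by simp
  qed
  ultimately have "0 < m u0 / u0" by simp
  show "\<exists>c>0. \<forall>u\<ge>\<delta>. c * u \<le> m u"
  proof (intro exI[of _ "min 1 (m u0 / u0)"] conjI allI impI)
    fix u assume u: "\<delta> \<le> u"
    then have "0 < u" using \<open>0 < \<delta>\<close> by simp
    show "min 1 (m u0 / u0) * u \<le> m u"
    proof (cases "N \<le> u")
      case True
      have "min 1 (m u0 / u0) * u \<le> 1 * u" using \<open>0 < u\<close> by (intro mult_right_mono) auto
      then show ?thesis using N(2)[OF True] by linarith
    next
      case False
      then have "m u0 / u0 \<le> m u / u" using u by (intro u0(2)) auto
      then have "min 1 (m u0 / u0) \<le> m u / u" by linarith
      then show ?thesis using \<open>0 < u\<close> by (simp add: pos_le_divide_eq)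
    qed
  qed (use \<open>0 < m u0 / u0\<close> in auto)
qed

text \<open>The quotient x^(q+1) / y^q is increasing in x, decreasing in y and homogeneous of degree
  one, so bounds of x and y by multiples of u yield a bound linear in u.\<close>

lemma action_density_le:
  fixes q :: real
  assumes "0 < q" "0 \<le> x" "x \<le> A * u" "B * u \<le> y" "0 < B" "0 < u" "0 \<le> A"
  shows "ennreal (x powr (q + 1)) / ennreal (y powr q) \<le> ennreal (A powr (q + 1) / B powr q * u)"
proof -
  have y: "0 < y" using assms by (meson less_le_trans mult_pos_pos)
  have "x powr (q + 1) \<le> (A * u) powr (q + 1)" using assms by (intro powr_mono2) auto
  moreover have "(B * u) powr q \<le> y powr q" using assms by (intro powr_mono2) auto
  ultimately have "x powr (q + 1) / y powr q \<le> (A * u) powr (q + 1) / (B * u) powr q"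
    using assms by (intro frac_le) auto
  also have "\<dots> = A powr (q + 1) / B powr q * u"
    using assms by (simp add: powr_mult powr_add)
  finally show ?thesis using y by (simp add: divide_ennreal ennreal_leI)
qed

text \<open>The weak form for a constant density at rest; it accounts for the background when a
  transport is lifted by \<delta>.\<close>

lemma integral_time_derivative:
  fixes \<phi> :: "real \<times> 'a::euclidean_space \<Rightarrow> real"
  assumes \<Omega>: "\<Omega> \<in> sets borel" "bounded \<Omega>"
    and diff: "\<And>z. \<phi> differentiable (at z)"
    and cont: "\<And>v. continuous_on UNIV (\<lambda>z. frechet_derivative \<phi> (at z) v)"
  shows "integrable lborel (\<lambda>p. indicator ({0..1} \<times> \<Omega>) p * frechet_derivative \<phi> (at p) (1, 0))"
    and "(\<integral>p. indicator ({0..1} \<times> \<Omega>) p * frechet_derivative \<phi> (at p) (1, 0) \<partial>lborel) =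
      (\<integral>x. indicator \<Omega> x * (\<phi> (1, x) - \<phi> (0, x)) \<partial>lborel)"
proof -
  let ?d = "\<lambda>p. frechet_derivative \<phi> (at p) (1, 0)"
  have [measurable]: "\<Omega> \<in> sets borel" by fact
  have prod [measurable]: "{0..1::real} \<times> \<Omega> \<in> sets borel" unfolding borel_prod[symmetric] by measurable
  have d [measurable]: "?d \<in> borel_measurable borel" using cont by (rule borel_measurable_continuous_onI)
  have "compact ({0..1::real} \<times> closure \<Omega>)" using \<Omega>(2) by (simp add: compact_Times)
  from frechet_derivative_bounded_on_compact[OF diff cont this]
  obtain C where C: "0 \<le> C" "\<And>z v. z \<in> {0..1} \<times> closure \<Omega> \<Longrightarrow> \<bar>frechet_derivative \<phi> (at z) v\<bar> \<le> C * norm v" by blast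
  have C': "\<bar>?d (t, x)\<bar> \<le> C" if "t \<in> {0..1}" "x \<in> \<Omega>" for t x
    using C(2)[of "(t, x)" "(1, 0)"] that closure_subset[of \<Omega>] by (auto simp: norm_Pair)
  have "emeasure lborel ({0..1::real} \<times> \<Omega>) < \<infinity>"
    using bounded_Times[OF bounded_closed_interval \<Omega>(2)] by (intro emeasure_bounded_finite)
  then have "integrable lborel (\<lambda>p. C * indicator ({0..1::real} \<times> \<Omega>) p)"
    by (intro integrable_mult_right integrable_real_indicator) auto
  then show int: "integrable lborel (\<lambda>p. indicator ({0..1} \<times> \<Omega>) p * ?d p)"
    by (rule Bochner_Integration.integrable_bound) (use C' C(1) in \<open>auto simp: indicator_def intro!: AE_I2\<close>)
  have "(\<integral>p. indicator ({0..1} \<times> \<Omega>) p * ?d p \<partial>lborel) =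
      (\<integral>x. \<integral>t. indicator ({0..1} \<times> \<Omega>) (t, x) * ?d (t, x) \<partial>lborel \<partial>lborel)"
    using lborel_pair.integral_snd[of "\<lambda>t x. indicator ({0..1} \<times> \<Omega>) (t, x) * ?d (t, x)"] int
    by (simp add: lborel_prod case_prod_unfold)
  also have "\<dots> = (\<integral>x. indicator \<Omega> x * (\<phi> (1, x) - \<phi> (0, x)) \<partial>lborel)"
  proof (rule Bochner_Integration.integral_cong[OF refl])
    fix x :: 'a
    show "(\<integral>t. indicator ({0..1} \<times> \<Omega>) (t, x) * ?d (t, x) \<partial>lborel) = indicator \<Omega> x * (\<phi> (1, x) - \<phi> (0, x))"
    proof (cases "x \<in> \<Omega>")
      case True
      have [measurable]: "(\<lambda>t. ?d (t, x)) \<in> borel_measurable borel"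
        by (intro borel_measurable_continuous_onI continuous_on_compose2[OF cont] continuous_intros) auto
      have ae: "AE t in lborel. t \<noteq> 0 \<and> t \<noteq> (1::real)"
        by (simp add: AE_lborel_singleton)
      have "(\<integral>t. indicator ({0..1} \<times> \<Omega>) (t, x) * ?d (t, x) \<partial>lborel) = (\<integral>t. indicator {0..1} t * ?d (t, x) \<partial>lborel)"
        using True by (intro Bochner_Integration.integral_cong) (auto simp: indicator_def)
      also have "\<dots> = (\<integral>t. indicator {0<..<1} t * ?d (t, x) \<partial>lborel)"
        by (intro integral_cong_AE) (use ae in \<open>measurable, eventually_elim, auto simp: indicator_def\<close>)
      also have "\<dots> = \<phi> (1, x) - \<phi> (0, x)"
      proof (rule integral_deriv_unit_interval[of "{}", where C = C])
        have "continuous_on UNIV \<phi>"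
          using diff by (simp add: differentiable_imp_continuous_on differentiable_on_def differentiable_at_withinI)
        then show "continuous_on {0..1} (\<lambda>t. \<phi> (t, x))"
          by (rule continuous_on_compose2) (auto intro!: continuous_intros)
        fix t :: real
        have d: "(\<phi> has_derivative frechet_derivative \<phi> (at (t, x))) (at (t, x))"
          using diff frechet_derivative_works by blast
        have "((\<lambda>t. (t, x)) has_derivative (\<lambda>h. h *\<^sub>R (1, 0))) (at t)"
          by (auto intro!: derivative_eq_intros)
        from has_derivative_compose[OF this d]
        show "((\<lambda>t. \<phi> (t, x)) has_vector_derivative ?d (t, x)) (at t)"
          unfolding has_vector_derivative_def linear_scale[OF has_derivative_linear[OF d]] .
      qed (use C' True in auto)
      finally show ?thesis using True by simp
    qed (simp add: indicator_def)
  qed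
  finally show "(\<integral>p. indicator ({0..1} \<times> \<Omega>) p * ?d p \<partial>lborel) =
      (\<integral>x. indicator \<Omega> x * (\<phi> (1, x) - \<phi> (0, x)) \<partial>lborel)" .
qed

lemma normalized_density:
  fixes v :: "'a::euclidean_space \<Rightarrow> real"
  assumes [measurable]: "v \<in> borel_measurable borel" and v: "\<And>x. 0 \<le> v x" "\<And>x. x \<notin> \<Omega> \<Longrightarrow> v x = 0"
    and "integrable lborel v" "0 < integral\<^sup>L lborel v"
  defines "P \<equiv> density lborel (\<lambda>x. ennreal (v x / integral\<^sup>L lborel v))"
  shows "prob_space P" "sets P = sets borel" "AE x in P. x \<in> \<Omega>"
    and "f \<in> borel_measurable borel \<Longrightarrow> integral\<^sup>L lborel v * (\<integral>x. f x \<partial>P) = (\<integral>x. v x * f x \<partial>lborel)"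
proof -
  let ?I = "integral\<^sup>L lborel v"
  show "prob_space P"
  proof
    have "emeasure P (space P) = (\<integral>\<^sup>+x. ennreal (v x / ?I) \<partial>lborel)"
      by (simp add: P_def emeasure_density)
    also have "\<dots> = ennreal (\<integral>x. v x / ?I \<partial>lborel)"
      using assms by (intro nn_integral_eq_integral) auto
    also have "\<dots> = 1" using assms(5) by simp
    finally show "emeasure P (space P) = 1" .
  qed
  show "sets P = sets borel" by (simp add: P_def)
  have "x \<in> \<Omega>" if "0 < ennreal (v x / ?I)" for x using v(2)[of x] that by (cases "x \<in> \<Omega>") auto
  then show "AE x in P. x \<in> \<Omega>" unfolding P_def by (simp add: AE_density)
  show "?I * (\<integral>x. f x \<partial>P) = (\<integral>x. v x * f x \<partial>lborel)" if [measurable]: "f \<in> borel_measurable borel"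
  proof -
    have "(\<integral>x. f x \<partial>P) = (\<integral>x. v x / ?I * f x \<partial>lborel)"
      unfolding P_def using v assms(5) by (subst integral_density) auto
    then show ?thesis using assms(5) by simp
  qed
qed

lemma integral_with_excess_density:
  fixes u v \<psi> :: "'a::euclidean_space \<Rightarrow> real"
  assumes \<Omega>: "\<Omega> \<in> sets borel" "bounded \<Omega>" and [measurable]: "v \<in> borel_measurable borel"
    and v: "\<And>x. x \<notin> \<Omega> \<Longrightarrow> v x = 0" "integrable lborel v"
    and u: "u \<in> borel_measurable (lebesgue_on \<Omega>)" "AE x in lebesgue_on \<Omega>. u x = \<delta> + v x"
    and \<psi>: "continuous_on UNIV \<psi>"
  shows "integrable lborel (\<lambda>x. indicator \<Omega> x * \<psi> x)"
    and "(LINT x|lebesgue_on \<Omega>. u x * \<psi> x) =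
      \<delta> * (\<integral>x. indicator \<Omega> x * \<psi> x \<partial>lborel) + (\<integral>x. v x * \<psi> x \<partial>lborel)"
proof -
  have [measurable]: "\<Omega> \<in> sets borel" by fact
  have \<psi>m [measurable]: "\<psi> \<in> borel_measurable borel" using \<psi> by (rule borel_measurable_continuous_onI)
  have "compact (\<psi> ` closure \<Omega>)"
    using \<Omega>(2) by (intro compact_continuous_image continuous_on_subset[OF \<psi>]) auto
  from compact_imp_bounded[OF this] obtain C where C: "\<And>x. x \<in> closure \<Omega> \<Longrightarrow> \<bar>\<psi> x\<bar> \<le> C"
    by (auto simp: bounded_iff)
  then have C': "x \<in> \<Omega> \<Longrightarrow> \<bar>\<psi> x\<bar> \<le> \<bar>C\<bar>" for x using closure_subset[of \<Omega>] by force
  have "emeasure lborel \<Omega> < \<infinity>" using \<Omega>(2) by (rule emeasure_bounded_finite)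
  then have "integrable lborel (\<lambda>x. \<bar>C\<bar> * indicator \<Omega> x)"
    by (intro integrable_mult_right integrable_real_indicator) auto
  then show i: "integrable lborel (\<lambda>x. indicator \<Omega> x * \<psi> x)"
    by (rule Bochner_Integration.integrable_bound) (use C' in \<open>auto simp: indicator_def intro!: AE_I2\<close>)
  have i2: "integrable lborel (\<lambda>x. v x * \<psi> x)"
  proof (rule Bochner_Integration.integrable_bound[OF integrable_mult_right[OF v(2), of "\<bar>C\<bar>"]])
    have "norm (v x * \<psi> x) \<le> norm (\<bar>C\<bar> * v x)" for x
      using C'[of x] v(1)[of x] mult_left_mono[of "\<bar>\<psi> x\<bar>" "\<bar>C\<bar>" "\<bar>v x\<bar>"]
      by (cases "x \<in> \<Omega>") (auto simp: abs_mult mult.commute)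
    then show "AE x in lborel. norm (v x * \<psi> x) \<le> norm (\<bar>C\<bar> * v x)" by simp
  qed simp
  have \<psi>l: "\<psi> \<in> borel_measurable (lebesgue_on \<Omega>)" "v \<in> borel_measurable (lebesgue_on \<Omega>)"
    by (auto simp: measurable_restrict_space1 measurable_completion)
  have "(LINT x|lebesgue_on \<Omega>. u x * \<psi> x) = (LINT x|lebesgue_on \<Omega>. (\<delta> + v x) * \<psi> x)"
    using u \<psi>l by (intro integral_cong_AE) auto
  also have "\<dots> = (\<integral>x. \<delta> * (indicator \<Omega> x * \<psi> x) + v x * \<psi> x \<partial>lborel)"
    by (subst integral_lebesgue_on_borel(1))
      (auto intro!: Bochner_Integration.integral_cong simp: indicator_def v(1) algebra_simps)
  also have "\<dots> = \<delta> * (\<integral>x. indicator \<Omega> x * \<psi> x \<partial>lborel) + (\<integral>x. v x * \<psi> x \<partial>lborel)"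
    using i i2 by simp
  finally show "(LINT x|lebesgue_on \<Omega>. u x * \<psi> x) =
      \<delta> * (\<integral>x. indicator \<Omega> x * \<psi> x \<partial>lborel) + (\<integral>x. v x * \<psi> x \<partial>lborel)" .
qed

lemma integral_lebesgue_on_empty: "(LINT x|lebesgue_on {}. f x) = (0 :: real)"
  by (simp add: integral_restrict_space)

text \<open>Treated apart because an empty \<Omega> leaves no positive mass to normalize and no
  point at which to place balls.\<close>

lemma bb_action_empty: "bb_action \<alpha> m ({} :: 'a::euclidean_space set) u0 u1 = 0"
proof -
  have "((\<lambda>_. 0, \<lambda>_. 0) :: (real \<times> 'a \<Rightarrow> real) \<times> (real \<times> 'a \<Rightarrow> 'a)) \<in> admissible {} u0 u1"
    by (simp add: admissible_def continuity_eq_def integral_lebesgue_on_empty)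
  then have "bb_action \<alpha> m {} u0 u1 \<le> action \<alpha> m {} (\<lambda>_ :: real \<times> 'a. 0) (\<lambda>_. 0)"
    unfolding bb_action_def by (rule INF_lower2) simp
  also have "\<dots> = 0" by (simp add: action_def nn_integral_restrict_space)
  finally show ?thesis by simp
qed

text \<open>The continuity equation is linear and solved by the pair (\<delta>, 0), so the
  background adds \<delta> to both end densities without any flux. The second claim is the mass
  integrated over a time interval of length 1; the action will be bounded by a multiple of
  it.\<close>

lemma lifted_transport_admissible:
  fixes \<Omega> :: "'a::euclidean_space set" and F :: "real \<times> 'a \<Rightarrow> real" and J :: "real \<times> 'a \<Rightarrow> 'a"
  assumes \<Omega>: "open \<Omega>" "bounded \<Omega>" and "0 \<le> \<delta>" "0 \<le> M"
    and v0: "v0 \<in> borel_measurable borel" "\<And>x. x \<notin> \<Omega> \<Longrightarrow> v0 x = 0" "integrable lborel v0"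
      "u0 \<in> borel_measurable (lebesgue_on \<Omega>)" "AE x in lebesgue_on \<Omega>. u0 x = \<delta> + v0 x"
    and v1: "v1 \<in> borel_measurable borel" "\<And>x. x \<notin> \<Omega> \<Longrightarrow> v1 x = 0" "integrable lborel v1"
      "u1 \<in> borel_measurable (lebesgue_on \<Omega>)" "AE x in lebesgue_on \<Omega>. u1 x = \<delta> + v1 x"
    and F: "integrable lborel F" "\<And>p. 0 \<le> F p" "\<And>p. p \<notin> {0..1} \<times> \<Omega> \<Longrightarrow> F p = 0"
    and J: "integrable lborel J" "\<And>p. p \<notin> {0..1} \<times> \<Omega> \<Longrightarrow> J p = 0"
    and weak: "\<And>\<phi> :: real \<times> 'a \<Rightarrow> real. (\<forall>z. \<phi> differentiable (at z)) \<Longrightarrow>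
      (\<forall>v. continuous_on UNIV (\<lambda>z. frechet_derivative \<phi> (at z) v)) \<Longrightarrow>
      integrable lborel (\<lambda>p. F p * frechet_derivative \<phi> (at p) (1, 0) + frechet_derivative \<phi> (at p) (0, J p)) \<and>
      M * (\<integral>p. F p * frechet_derivative \<phi> (at p) (1, 0) + frechet_derivative \<phi> (at p) (0, J p) \<partial>lborel) =
      (\<integral>x. v1 x * \<phi> (1, x) \<partial>lborel) - (\<integral>x. v0 x * \<phi> (0, x) \<partial>lborel)"
  shows "(\<lambda>p. \<delta> + M * F p, \<lambda>p. M *\<^sub>R J p) \<in> admissible \<Omega> u0 u1"
    and "(\<integral>\<^sup>+p. ennreal (\<delta> + M * F p) \<partial>lebesgue_on ({0..1} \<times> \<Omega>)) =
      ennreal (\<delta> * measure lborel \<Omega> + M * integral\<^sup>L lborel F)"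
proof -
  have [measurable]: "\<Omega> \<in> sets borel" using \<Omega>(1) by simp
  let ?Q = "{0..1::real} \<times> \<Omega>"
  have Q [measurable]: "?Q \<in> sets borel" unfolding borel_prod[symmetric] by measurable
  have [measurable]: "F \<in> borel_measurable borel" "J \<in> borel_measurable borel"
    using F(1) J(1) by auto
  have "emeasure lborel ?Q < \<infinity>"
    using bounded_Times[OF bounded_closed_interval \<Omega>(2)] by (intro emeasure_bounded_finite)
  then have iQ: "integrable lborel (\<lambda>p. indicator ?Q p * \<delta>)"
    by (intro integrable_mult_left integrable_real_indicator) auto
  have ind: "indicator ?Q p *\<^sub>R (\<delta> + M * F p) = indicator ?Q p * \<delta> + M * F p" for p
    using F(3)[of p] by (cases "p \<in> ?Q") auto
  have indJ: "indicator ?Q p *\<^sub>R (M *\<^sub>R J p) = M *\<^sub>R J p" for p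
    using J(2)[of p] by (cases "p \<in> ?Q") auto
  have iu: "integrable (lebesgue_on ?Q) (\<lambda>p. \<delta> + M * F p)"
    using iQ F(1) by (subst integral_lebesgue_on_borel(2)) (auto simp only: ind, auto)
  have ij: "integrable (lebesgue_on ?Q) (\<lambda>p. M *\<^sub>R J p)"
    using J(1) by (subst integral_lebesgue_on_borel(2)) (auto simp only: indJ, auto)
  have ce: "continuity_eq \<Omega> (\<lambda>p. \<delta> + M * F p) (\<lambda>p. M *\<^sub>R J p) u0 u1"
    unfolding continuity_eq_def
  proof (intro allI impI)
    fix \<phi> :: "real \<times> 'a \<Rightarrow> real" assume "test_function \<phi>"
    note \<phi> = test_function_C1[OF this]
    let ?d = "\<lambda>p. frechet_derivative \<phi> (at p)"
    note w = weak[of \<phi>, OF allI[OF \<phi>(1)] allI[OF \<phi>(2)]]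
    note td = integral_time_derivative[OF \<open>\<Omega> \<in> sets borel\<close> \<Omega>(2) \<phi>]
    have c: "continuous_on UNIV \<phi>"
      using \<phi>(1) by (simp add: differentiable_imp_continuous_on differentiable_on_def differentiable_at_withinI)
    have c': "continuous_on UNIV (\<lambda>x. \<phi> (t, x))" for t
      by (intro continuous_on_compose2[OF c] continuous_intros) auto
    have lin: "linear (?d p)" for p using \<phi>(1) by (simp add: linear_frechet_derivative)
    have d0: "?d p (0, 0) = 0" "?d p (0, M *\<^sub>R J p) = M * ?d p (0, J p)" for p
      using linear_0[OF lin[of p]] linear_scale[OF lin[of p], of M "(0, J p)"] by (auto simp: zero_prod_def)
    have dm: "(\<lambda>p. ?d p (1, 0)) \<in> borel_measurable borel" "(\<lambda>p. ?d p (0, M *\<^sub>R J p)) \<in> borel_measurable borel"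
      by (auto intro!: frechet_derivative_measurable[OF \<phi>])
    have "(LINT p|lebesgue_on ?Q. (\<delta> + M * F p) * ?d p (1, 0) + ?d p (0, M *\<^sub>R J p)) =
        (\<integral>p. indicator ?Q p *\<^sub>R ((\<delta> + M * F p) * ?d p (1, 0) + ?d p (0, M *\<^sub>R J p)) \<partial>lborel)"
      using dm by (subst integral_lebesgue_on_borel(1)) auto
    also have "\<dots> = (\<integral>p. \<delta> * (indicator ?Q p * ?d p (1, 0)) + M * (F p * ?d p (1, 0) + ?d p (0, J p)) \<partial>lborel)"
    proof (rule Bochner_Integration.integral_cong[OF refl])
      fix p
      show "indicator ?Q p *\<^sub>R ((\<delta> + M * F p) * ?d p (1, 0) + ?d p (0, M *\<^sub>R J p)) =
        \<delta> * (indicator ?Q p * ?d p (1, 0)) + M * (F p * ?d p (1, 0) + ?d p (0, J p))"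
        using F(3)[of p] J(2)[of p] d0[of p] by (cases "p \<in> ?Q") (auto simp: algebra_simps)
    qed
    also have "\<dots> = \<delta> * (\<integral>p. indicator ?Q p * ?d p (1, 0) \<partial>lborel) +
        M * (\<integral>p. F p * ?d p (1, 0) + ?d p (0, J p) \<partial>lborel)"
      using td(1) w by simp
    also have "\<dots> = \<delta> * (\<integral>x. indicator \<Omega> x * (\<phi> (1, x) - \<phi> (0, x)) \<partial>lborel) +
        ((\<integral>x. v1 x * \<phi> (1, x) \<partial>lborel) - (\<integral>x. v0 x * \<phi> (0, x) \<partial>lborel))"
      using td(2) w by simp
    also have "\<dots> = (LINT x|lebesgue_on \<Omega>. u1 x * \<phi> (1, x)) - (LINT x|lebesgue_on \<Omega>. u0 x * \<phi> (0, x))"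
      using integral_with_excess_density[OF \<open>\<Omega> \<in> sets borel\<close> \<Omega>(2) v1 c'[of 1]]
        integral_with_excess_density[OF \<open>\<Omega> \<in> sets borel\<close> \<Omega>(2) v0 c'[of 0]]
      by (simp add: right_diff_distrib)
    finally show "(LINT p|lebesgue_on ?Q. (\<delta> + M * F p) * ?d p (1, 0) + ?d p (0, M *\<^sub>R J p)) =
      (LINT x|lebesgue_on \<Omega>. u1 x * \<phi> (1, x)) - (LINT x|lebesgue_on \<Omega>. u0 x * \<phi> (0, x))" .
  qed
  have pos: "0 \<le> \<delta> + M * F p" for p using assms(3,4) F(2)[of p] by simp
  show "(\<lambda>p. \<delta> + M * F p, \<lambda>p. M *\<^sub>R J p) \<in> admissible \<Omega> u0 u1"
    unfolding admissible_def using iu ij pos ce by simp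
  have "measure lborel ?Q = measure lborel \<Omega>"
    using lborel.emeasure_pair_measure_Times[of "{0..1::real}" lborel \<Omega>]
    by (simp add: measure_def lborel_prod)
  then show "(\<integral>\<^sup>+p. ennreal (\<delta> + M * F p) \<partial>lebesgue_on ?Q) = ennreal (\<delta> * measure lborel \<Omega> + M * integral\<^sup>L lborel F)"
    using nn_integral_eq_integral[OF iu] pos iQ F(1)
    by (simp add: integral_lebesgue_on_borel(1) ind mult.commute del: real_scaleR_def)
qed

section \<open>Choice of the constants and conclusion\<close>

theorem propositionA1:
  fixes \<Omega> :: "'a::euclidean_space set" and \<alpha> :: real and m :: "real \<Rightarrow> real"
  assumes "\<alpha> > 0"
    and "open \<Omega>" and "bounded \<Omega>" and "connected \<Omega>" and "lipschitz_boundary \<Omega>"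
    and "m \<in> {0..} \<rightarrow> {0..}" and "continuous_on {0..} m"
    and "filterlim (\<lambda>u. m u / u) at_top at_top"
    and "{u \<in> {0..}. m u = 0} = {0}"
  shows "\<forall>u0 u1. integrable (lebesgue_on \<Omega>) u0 \<longrightarrow> integrable (lebesgue_on \<Omega>) u1 \<longrightarrow>
           mean \<Omega> u0 = mean \<Omega> u1 \<longrightarrow>
           ess_inf (lebesgue_on \<Omega>) u0 > 0 \<longrightarrow> ess_inf (lebesgue_on \<Omega>) u1 > 0 \<longrightarrow>
           bb_action \<alpha> m \<Omega> u0 u1 = 0"
proof (intro allI impI)
  fix u0 u1 :: "'a \<Rightarrow> real"
  assume u0: "integrable (lebesgue_on \<Omega>) u0" and u1: "integrable (lebesgue_on \<Omega>) u1"
    and mean: "mean \<Omega> u0 = mean \<Omega> u1"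
    and inf0: "ess_inf (lebesgue_on \<Omega>) u0 > 0" and inf1: "ess_inf (lebesgue_on \<Omega>) u1 > 0"
  show "bb_action \<alpha> m \<Omega> u0 u1 = 0"
  proof (cases "\<Omega> = {}")
    case True
    then show ?thesis by (simp add: bb_action_empty)
  next
    case False
    have [measurable]: "\<Omega> \<in> sets borel" using \<open>open \<Omega>\<close> by simp
    have fin: "emeasure lborel \<Omega> < \<infinity>" using \<open>bounded \<Omega>\<close> by (rule emeasure_bounded_finite)
    define vol where "vol = measure lborel \<Omega>"
    have "emeasure lborel \<Omega> \<noteq> 0"
      using open_not_negligible[OF \<open>open \<Omega>\<close> False] by (simp add: negligible_iff_emeasure0)
    then have vol: "0 < vol"
      using fin by (simp add: vol_def measure_def enn2real_positive_iff zero_less_iff_neq_zero)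
    define T where "T = (LINT x|lebesgue_on \<Omega>. u0 x)"
    have T1: "(LINT x|lebesgue_on \<Omega>. u1 x) = T"
      using mean vol unfolding mean_def T_def by (simp add: vol_def)
    obtain \<delta>0 where "0 < \<delta>0" and \<delta>0: "AE x in lebesgue_on \<Omega>. \<delta>0 \<le> u0 x" using ess_inf_pos[OF inf0] .
    obtain \<delta>1 where "0 < \<delta>1" and \<delta>1: "AE x in lebesgue_on \<Omega>. \<delta>1 \<le> u1 x" using ess_inf_pos[OF inf1] .
    \<comment> \<open>Half of the smaller lower bound: the excess mass is then at least \<delta>
      times the volume, hence positive, and the excess densities can be normalized to
      probabilities.\<close>
    define \<delta> where "\<delta> = min \<delta>0 \<delta>1 / 2"
    have \<delta>: "0 < \<delta>" using \<open>0 < \<delta>0\<close> \<open>0 < \<delta>1\<close> by (simp add: \<delta>_def)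
    have \<delta>_le: "2 * \<delta> \<le> \<delta>0" "2 * \<delta> \<le> \<delta>1" by (simp_all add: \<delta>_def)
    have ae0: "AE x in lebesgue_on \<Omega>. \<delta> \<le> u0 x" "AE x in lebesgue_on \<Omega>. 2 * \<delta> \<le> u0 x"
      by (rule eventually_mono[OF \<delta>0], use \<delta> \<delta>_le in linarith)+
    have ae1: "AE x in lebesgue_on \<Omega>. \<delta> \<le> u1 x"
      by (rule eventually_mono[OF \<delta>1]) (use \<delta> \<delta>_le in linarith)
    have "2 * \<delta> * vol \<le> T"
    proof (rule excess_density[OF \<open>\<Omega> \<in> sets borel\<close> u0 ae0(2) fin])
      fix w :: "'a \<Rightarrow> real"
      assume "\<And>x. 0 \<le> w x" "(LINT x|lebesgue_on \<Omega>. u0 x) = 2 * \<delta> * measure lborel \<Omega> + integral\<^sup>L lborel w"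
      then show ?thesis by (simp add: T_def vol_def)
    qed
    obtain v0 where v0 [measurable]: "v0 \<in> borel_measurable borel" and v0': "\<And>x. 0 \<le> v0 x" "\<And>x. x \<notin> \<Omega> \<Longrightarrow> v0 x = 0"
      "integrable lborel v0" "AE x in lebesgue_on \<Omega>. u0 x = \<delta> + v0 x" and v0'': "(LINT x|lebesgue_on \<Omega>. u0 x) = \<delta> * measure lborel \<Omega> + integral\<^sup>L lborel v0"
      by (rule excess_density[OF \<open>\<Omega> \<in> sets borel\<close> u0 ae0(1) fin]) rule
    obtain v1 where v1 [measurable]: "v1 \<in> borel_measurable borel" and v1': "\<And>x. 0 \<le> v1 x" "\<And>x. x \<notin> \<Omega> \<Longrightarrow> v1 x = 0"
      "integrable lborel v1" "AE x in lebesgue_on \<Omega>. u1 x = \<delta> + v1 x" and v1'': "(LINT x|lebesgue_on \<Omega>. u1 x) = \<delta> * measure lborel \<Omega> + integral\<^sup>L lborel v1"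
      by (rule excess_density[OF \<open>\<Omega> \<in> sets borel\<close> u1 ae1 fin]) rule
    define mass where "mass = T - \<delta> * vol"
    have mass: "0 < mass" "integral\<^sup>L lborel v0 = mass" "integral\<^sup>L lborel v1 = mass" "\<delta> * vol + mass = T"
      using \<open>2 * \<delta> * vol \<le> T\<close> mult_pos_pos[OF \<delta> vol] v0'' v1'' T1 by (auto simp: mass_def T_def vol_def)
    have "0 < T" using mass mult_pos_pos[OF \<delta> vol] by linarith
    have n0: "prob_space (density lborel (\<lambda>x. ennreal (v0 x / mass)))"
      "sets (density lborel (\<lambda>x. ennreal (v0 x / mass))) = sets borel"
      "AE x in density lborel (\<lambda>x. ennreal (v0 x / mass)). x \<in> \<Omega>"
      "f \<in> borel_measurable borel \<Longrightarrow> mass * (\<integral>x. f x \<partial>density lborel (\<lambda>x. ennreal (v0 x / mass))) =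
        (\<integral>x. v0 x * f x \<partial>lborel)" for f
      using normalized_density[of v0 \<Omega>, unfolded mass(2), OF v0 v0'(1,2,3) mass(1)] by blast+
    have n1: "prob_space (density lborel (\<lambda>x. ennreal (v1 x / mass)))"
      "sets (density lborel (\<lambda>x. ennreal (v1 x / mass))) = sets borel"
      "AE x in density lborel (\<lambda>x. ennreal (v1 x / mass)). x \<in> \<Omega>"
      "f \<in> borel_measurable borel \<Longrightarrow> mass * (\<integral>x. f x \<partial>density lborel (\<lambda>x. ennreal (v1 x / mass))) =
        (\<integral>x. v1 x * f x \<partial>lborel)" for f
      using normalized_density[of v1 \<Omega>, unfolded mass(3), OF v1 v1'(1,2,3) mass(1)] by blast+
    obtain c where c: "0 < c" "\<And>u. \<delta> \<le> u \<Longrightarrow> c * u \<le> m u"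
      using superlinear_lower_bounds(2)[OF assms(7,6,9,8) \<delta>] by blast
    define q where "q = 1 / \<alpha>"
    have q: "0 < q" "(\<alpha> + 1) / \<alpha> = q + 1" using \<open>\<alpha> > 0\<close> by (auto simp: q_def field_simps)
    have "bb_action \<alpha> m \<Omega> u0 u1 \<le> 0 + ennreal e" if e: "0 < e" for e :: real
    proof -
      \<comment> \<open>The action will be at most \<open>e'\<close> times the space-time integral
        of the density, which is \<open>T\<close>.\<close>
      define e' where "e' = e / T"
      have e': "0 < e'" using e \<open>0 < T\<close> by (simp add: e'_def)
      \<comment> \<open>Solves \<epsilon>^(q+1) / c^q = e', where the left side is the cost of slow
        motion per unit of density.\<close>
      define \<epsilon> where "\<epsilon> = (e' * c powr q) powr (1 / (q + 1))"
      have \<epsilon>: "0 < \<epsilon>" "\<epsilon> powr (q + 1) / c powr q \<le> e'"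
        using e' c(1) q(1) by (auto simp: \<epsilon>_def powr_powr)
      let ?P = "\<lambda>v. density lborel (\<lambda>x. ennreal (v x / mass))"
      obtain D where "0 \<le> D" and transport: "\<And>M. 0 < M \<Longrightarrow> \<exists>F J. transports \<Omega> (?P v0) (?P v1) F J \<and>
        (\<forall>p. norm (J p) \<le> \<epsilon> * F p \<or> norm (J p) \<le> D * F p \<and> (F p = 0 \<or> M \<le> F p))"
        by (rule concentrating_transport[OF assms(2-5) False n0(1-3) n1(1-3) \<epsilon>(1)]) rule
      \<comment> \<open>Chosen after \<open>D\<close>, to pay for the fast motion; the added 1 keeps
        \<open>K\<close> positive if \<open>D\<close> is 0.\<close>
      define K where "K = ((D powr (q + 1) + 1) / e') powr (1 / q)"
      have "0 < D powr (q + 1) + 1" by (simp add: add_nonneg_pos)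
      then have K: "0 < K" "D powr (q + 1) / K powr q \<le> e'"
        using e' q(1) by (auto simp: K_def powr_powr field_simps)
      obtain N where N: "0 < N" "\<And>u. N \<le> u \<Longrightarrow> K * u \<le> m u"
        using superlinear_lower_bounds(1)[OF assms(7,6,9,8)] by blast
      \<comment> \<open>The transport carries unit mass; after scaling by \<open>mass\<close> this
        threshold becomes \<open>N\<close>.\<close>
      have "0 < N / mass" using N(1) mass(1) by simp
      from transport[OF this] obtain F J where tr: "transports \<Omega> (?P v0) (?P v1) F J"
        and FJ: "\<And>p. norm (J p) \<le> \<epsilon> * F p \<or> norm (J p) \<le> D * F p \<and> (F p = 0 \<or> N / mass \<le> F p)"
        by blast
      have F: "integrable lborel F" "\<And>p. 0 \<le> F p" "\<And>p. p \<notin> {0..1} \<times> \<Omega> \<Longrightarrow> F p = 0" "integral\<^sup>L lborel F = 1"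
        and J: "integrable lborel J"
        using tr unfolding transports_def by blast+
      have weak: "integrable lborel (\<lambda>p. F p * frechet_derivative \<phi> (at p) (1, 0) + frechet_derivative \<phi> (at p) (0, J p)) \<and>
          (\<integral>p. F p * frechet_derivative \<phi> (at p) (1, 0) + frechet_derivative \<phi> (at p) (0, J p) \<partial>lborel) =
          (\<integral>x. \<phi> (1, x) \<partial>?P v1) - (\<integral>x. \<phi> (0, x) \<partial>?P v0)"
        if "\<forall>z. \<phi> differentiable (at z)" "\<forall>v. continuous_on UNIV (\<lambda>z. frechet_derivative \<phi> (at z) v)"
        for \<phi> :: "real \<times> 'a \<Rightarrow> real"
        using tr that unfolding transports_def by blast+
      have J0: "J p = 0" if "p \<notin> {0..1} \<times> \<Omega>" for p using FJ[of p] F(3)[OF that] by simp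
      have weak': "integrable lborel (\<lambda>p. F p * frechet_derivative \<phi> (at p) (1, 0) + frechet_derivative \<phi> (at p) (0, J p)) \<and>
          mass * (\<integral>p. F p * frechet_derivative \<phi> (at p) (1, 0) + frechet_derivative \<phi> (at p) (0, J p) \<partial>lborel) =
          (\<integral>x. v1 x * \<phi> (1, x) \<partial>lborel) - (\<integral>x. v0 x * \<phi> (0, x) \<partial>lborel)"
        if \<phi>: "\<forall>z. \<phi> differentiable (at z)" "\<forall>v. continuous_on UNIV (\<lambda>z. frechet_derivative \<phi> (at z) v)"
        for \<phi> :: "real \<times> 'a \<Rightarrow> real"
      proof -
        have "continuous_on UNIV \<phi>"
          using \<phi>(1) by (simp add: differentiable_imp_continuous_on differentiable_on_def differentiable_at_withinI)
        then have "continuous_on UNIV (\<lambda>x. \<phi> (t, x))" for t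
          by (rule continuous_on_compose2) (auto intro!: continuous_intros)
        then have \<phi>m: "(\<lambda>x. \<phi> (t, x)) \<in> borel_measurable borel" for t
          by (rule borel_measurable_continuous_onI)
        show ?thesis
          using weak[OF \<phi>] unfolding n0(4)[OF \<phi>m, symmetric] n1(4)[OF \<phi>m, symmetric] right_diff_distrib[symmetric]
          by (elim conjE) (intro conjI arg_cong[of _ _ "(*) mass"])
      qed
      let ?u = "\<lambda>p. \<delta> + mass * F p" and ?j = "\<lambda>p. mass *\<^sub>R J p"
      have m0: "0 \<le> \<delta>" "0 \<le> mass" using \<delta> mass(1) by auto
      have u0m: "u0 \<in> borel_measurable (lebesgue_on \<Omega>)" "u1 \<in> borel_measurable (lebesgue_on \<Omega>)" using u0 u1 by auto
      have lifted: "(?u, ?j) \<in> admissible \<Omega> u0 u1"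
        "(\<integral>\<^sup>+p. ennreal (?u p) \<partial>lebesgue_on ({0..1} \<times> \<Omega>)) = ennreal (\<delta> * measure lborel \<Omega> + mass * integral\<^sup>L lborel F)"
        by (rule lifted_transport_admissible[where ?v0.0 = v0 and ?v1.0 = v1 and ?u0.0 = u0 and ?u1.0 = u1 and J = J];
            fact)+
      have pw: "ennreal (norm (?j p) powr ((\<alpha> + 1) / \<alpha>)) / ennreal (m (?u p) powr (1 / \<alpha>)) \<le> ennreal e' * ennreal (?u p)" for p
      proof -
        have up: "\<delta> \<le> ?u p" "mass * F p \<le> ?u p" "0 < ?u p"
          using F(2)[of p] \<delta> mass(1) by (auto intro: add_pos_nonneg)
        have bound: "ennreal (norm (?j p) powr (q + 1)) / ennreal (m (?u p) powr q) \<le> ennreal (e' * ?u p)"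
          if "norm (J p) \<le> A * F p" "B * ?u p \<le> m (?u p)" "0 < B" "0 \<le> A" "A powr (q + 1) / B powr q \<le> e'" for A B
        proof -
          have "norm (?j p) \<le> A * (mass * F p)"
            using mult_left_mono[OF that(1), of mass] mass(1) by (simp add: mult.left_commute)
          also have "\<dots> \<le> A * ?u p" using up(2) that(4) by (rule mult_left_mono)
          finally have "ennreal (norm (?j p) powr (q + 1)) / ennreal (m (?u p) powr q) \<le>
              ennreal (A powr (q + 1) / B powr q * ?u p)"
            using that up(3) q(1) by (intro action_density_le) auto
          also have "\<dots> \<le> ennreal (e' * ?u p)" using that(5) up(3) by (intro ennreal_leI mult_right_mono) auto
          finally show ?thesis .
        qed
        have "ennreal (norm (?j p) powr (q + 1)) / ennreal (m (?u p) powr q) \<le> ennreal (e' * ?u p)"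
          using FJ[of p]
        proof (elim disjE conjE)
          assume "norm (J p) \<le> \<epsilon> * F p"
          then show ?thesis using c up(1) \<epsilon> by (intro bound[of \<epsilon> c]) auto
        next
          \<comment> \<open>Here the density is the bare background, possibly too small for the
            factor \<open>K\<close>; but the flux is 0, so the slow bound applies.\<close>
          assume "norm (J p) \<le> D * F p" "F p = 0"
          then show ?thesis using c up(1) \<epsilon> by (intro bound[of \<epsilon> c]) auto
        next
          assume "norm (J p) \<le> D * F p" "N / mass \<le> F p"
          moreover from this have "N \<le> mass * F p" using mass(1) by (simp add: pos_divide_le_eq mult.commute)
          then have "N \<le> ?u p" using up(2) by linarith
          ultimately show ?thesis using N(2)[of "?u p"] K \<open>0 \<le> D\<close> by (intro bound[of D K]) auto
        qed
        then show ?thesis using e' up(3) unfolding q(2) by (simp add: q_def[symmetric] ennreal_mult)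
      qed
      have "bb_action \<alpha> m \<Omega> u0 u1 \<le> action \<alpha> m \<Omega> ?u ?j"
        unfolding bb_action_def using lifted(1) by (rule INF_lower2) simp
      also have "\<dots> \<le> (\<integral>\<^sup>+p. ennreal e' * ennreal (?u p) \<partial>lebesgue_on ({0..1} \<times> \<Omega>))"
        unfolding action_def by (intro nn_integral_mono pw)
      also have "\<dots> = ennreal e' * (\<integral>\<^sup>+p. ennreal (?u p) \<partial>lebesgue_on ({0..1} \<times> \<Omega>))"
        using F(1) by (intro nn_integral_cmult) (auto intro!: measurable_restrict_space1 measurable_completion)
      also have "\<dots> = ennreal e' * ennreal T"
        using lifted(2) F(4) mass(4) by (simp add: vol_def)
      also have "\<dots> = ennreal e" using e \<open>0 < T\<close> by (simp add: e'_def ennreal_mult[symmetric])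
      finally show ?thesis by simp
    qed
    then have "bb_action \<alpha> m \<Omega> u0 u1 \<le> 0" by (rule ennreal_le_epsilon)
    then show ?thesis by simp
  qed
qed

end
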